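(* Suppose that $a$ and $n$ are integers with $n>a>0$ and $a^2<2n$. Then the digraph $\vec{C}_3(n-a,n,n+a)$ is DHS if and only if $a$ is not divisible by a prime that is congruent to $1$ modulo $6$.
   Context: A mixed graph $D$ is obtained from a finite simple undirected graph by orienting a subset of its edges; each edge is either undirected or an arc in exactly one direction. Its Hermitian adjacency matrix $H(D)\in\mathbb{C}^{V\times V}$, $V=V(D)$, has $(u,v)$-entry $1$ if $uv$ is an undirected edge, $i$ (imaginary unit) if there is an arc from $u$ to $v$, $-i$ if there is an arc from $v$ to $u$, and $0$ otherwise. Two mixed graphs are $H$-cospectral if their Hermitian adjacency matrices have the same eigenvalues with the same multiplicities. Let $\mathcal{S}$ be the set of diagonal matrices indexed by $V$ with all diagonal entries in $\{1,-1,i,-i\}$. A mixed graph $D'$ on the vertex set $V(D)$ is obtained from $D$ by a four-way switching if $H(D')=S^{-1}H(D)S$ for some $S\in\mathcal{S}$. A mixed graph $D$ is determined by its Hermitian spectrum (DHS) if every mixed graph that is $H$-cospectral with $D$ is isomorphic to a mixed graph that can be obtained from $D$ by a four-way switching, possibly followed by the reversal of all directed edges. For positive integers $a,b,c$, $\vec{C}_3(a,b,c)$ is the complete tripartite mixed graph with parts $A,B,C$, $|A|=a$, $|B|=b$, $|C|=c$, having all arcs from $A$ to $B$, all arcs from $B$ to $C$, and all arcs from $C$ to $A$ (and no other edges). *)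

theory Defs
  imports
    Complex_Main
    "HOL-Number_Theory.Cong"
    "HOL-Computational_Algebra.Polynomial"
    "HOL-Computational_Algebra.Primes"
    "Jordan_Normal_Form.Char_Poly"
begin

(* Mixed graphs are labelled: the vertex set is {..<nverts D}. Up to isomorphism this covers all
   finite mixed graphs. Undirected edges are two-element vertex sets; (u, v) is an arc from u
   to v. *)

record mixed_graph =
  nverts :: nat
  uedges :: "nat set set"
  arcs :: "(nat \<times> nat) set"

abbreviation verts :: "mixed_graph \<Rightarrow> nat set" where
  "verts D \<equiv> {..<nverts D}"

definition is_mixed_graph :: "mixed_graph \<Rightarrow> bool" where
  "is_mixed_graph D \<longleftrightarrow>
     uedges D \<subseteq> {{u, v} | u v. u \<in> verts D \<and> v \<in> verts D \<and> u \<noteq> v} \<and>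
     arcs D \<subseteq> {(u, v). u \<in> verts D \<and> v \<in> verts D \<and> u \<noteq> v} \<and>
     (\<forall>(u, v) \<in> arcs D. (v, u) \<notin> arcs D \<and> {u, v} \<notin> uedges D)"

definition herm_adj :: "mixed_graph \<Rightarrow> complex mat" where
  "herm_adj D = mat (nverts D) (nverts D) (\<lambda>(u, v).
     if {u, v} \<in> uedges D then 1
     else if (u, v) \<in> arcs D then \<i>
     else if (v, u) \<in> arcs D then - \<i>
     else 0)"

(* The multiset of eigenvalues, i.e. of roots of the characteristic polynomial. *)
definition herm_spectrum :: "mixed_graph \<Rightarrow> complex multiset" where
  "herm_spectrum D = proots (char_poly (herm_adj D))"

definition H_cospectral :: "mixed_graph \<Rightarrow> mixed_graph \<Rightarrow> bool" where
  "H_cospectral D D' \<longleftrightarrow> herm_spectrum D = herm_spectrum D'"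

definition switching_matrices :: "nat \<Rightarrow> complex mat set" where
  "switching_matrices m =
     {S \<in> carrier_mat m m. diagonal_mat S \<and> (\<forall>v<m. S $$ (v, v) \<in> {1, -1, \<i>, - \<i>})}"

(* The witness T is the inverse of S: similar_mat_wit A B T S says that S and T are mutually
   inverse and A = T * B * S. *)
definition four_way_switching :: "mixed_graph \<Rightarrow> mixed_graph \<Rightarrow> bool" where
  "four_way_switching D D' \<longleftrightarrow>
     is_mixed_graph D' \<and> nverts D' = nverts D \<and>
     (\<exists>S \<in> switching_matrices (nverts D). \<exists>T. similar_mat_wit (herm_adj D') (herm_adj D) T S)"

definition reversal :: "mixed_graph \<Rightarrow> mixed_graph" where
  "reversal D = D\<lparr>arcs := (arcs D)\<inverse>\<rparr>"

definition isomorphic :: "mixed_graph \<Rightarrow> mixed_graph \<Rightarrow> bool" where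
  "isomorphic D D' \<longleftrightarrow>
     (\<exists>f. bij_betw f (verts D) (verts D') \<and>
       (\<forall>u \<in> verts D. \<forall>v \<in> verts D.
          ({u, v} \<in> uedges D \<longleftrightarrow> {f u, f v} \<in> uedges D') \<and>
          ((u, v) \<in> arcs D \<longleftrightarrow> (f u, f v) \<in> arcs D')))"

definition DHS :: "mixed_graph \<Rightarrow> bool" where
  "DHS D \<longleftrightarrow>
     (\<forall>D'. is_mixed_graph D' \<and> H_cospectral D' D \<longrightarrow>
       (\<exists>D''. four_way_switching D D'' \<and>
          (isomorphic D' D'' \<or> isomorphic D' (reversal D''))))"

definition C3_vec :: "nat \<Rightarrow> nat \<Rightarrow> nat \<Rightarrow> mixed_graph" where
  "C3_vec a b c =
     (let A = {..<a}; B = {a..<a + b}; C = {a + b..<a + b + c}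
      in \<lparr>nverts = a + b + c, uedges = {}, arcs = A \<times> B \<union> B \<times> C \<union> C \<times> A\<rparr>)"

lemma is_mixed_graph_C3_vec: "is_mixed_graph (C3_vec a b c)"
  by (auto simp: is_mixed_graph_def C3_vec_def Let_def)

end

(* The matrix H of C3(a,b,c) satisfies H^3 = s H with s = ab + bc + ca, so its spectrum is
   {sqrt s, -sqrt s} together with zeros and depends only on a + b + c and s. Conversely, a mixed
   graph with such a spectrum has a matrix of rank two; the vanishing of the 3x3 minors through an
   edge ij expresses every entry by the rows and columns of i and j, and this forces the graph to
   be a four-way switching of some C3(p,q,r) plus t isolated vertices, with the same sums. For the sizes
   n - a, n, n + a the bound a^2 < 2n excludes isolated vertices, and p = n + x, q = n + y turns
   the equality of the sums into x^2 + xy + y^2 = a^2. This has only the solutions with x = 0, y = 0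
   or x + y = 0, i.e. the permutations of the given sizes, precisely when a has no prime
   factor congruent to 1 modulo 6; odd permutations of the parts are reversals. *)
theory Submission
  imports
    Defs
    "HOL-Number_Theory.Number_Theory"
    "Jordan_Normal_Form.Schur_Decomposition"
begin

text \<open>Rank two is a strong condition here because every nonzero entry is a unit. The 3x3 minor
  on a triangle i, j, k is twice the real part of \<open>h i j * h j k * h k i\<close>, so this
  weight, which no switching changes, is \<open>\<i>\<close> or \<open>- \<i>\<close>. All triangles
  on one edge carry the same sign, since two different signs would produce an entry of modulus 2.
  The sign fixes the cyclic order of the three parts, and reading the edge backwards conjugates it,
  so one orientation can be assumed.

  The form x^2 + xy + y^2 is the norm of the Eisenstein integer x - y\<omega>, where \<omega> is a
  primitive cube root of unity. The trivial solutions are a times the six units, one for each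
  ordering of the sizes n - a, n, n + a. Primes congruent to 1 modulo 6 split in this ring, and a
  split prime factor of a gives elements of norm a^2 that are not a times a unit.

  The bound a^2 < 2n also has a second use: for a nontrivial solution it keeps n + x, n + y and n -
  x - y positive, so that they are part sizes of a cospectral graph.\<close>

section \<open>Squares as norms of Eisenstein integers\<close>

text \<open>Modulo \<open>q\<close> the number \<open>w\<close> is a cube root of unity, and it is
  not 1 because q is not 3. So 3 divides q - 1 by Fermat, and q is odd because w^2 + w + 1 always
  is.\<close>

lemma prime_imp_cong_1_mod_6:
  fixes w :: int and q :: nat
  assumes q: "prime q" and w: "[w\<^sup>2 + w + 1 = 0] (mod int q)" and q3: "q \<noteq> 3"
  shows "[q = 1] (mod 6)"
proof -
  have odd: "odd (w\<^sup>2 + w + 1)" by simp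
  have q2: "q \<noteq> 2"
    using w odd by (auto simp: cong_0_iff)
  have ndvd: "\<not> int q dvd w"
  proof
    assume "int q dvd w"
    then have "int q dvd (w\<^sup>2 + w + 1) - w * (w + 1)"
      using w by (intro dvd_diff) (auto simp: cong_0_iff)
    then have "int q dvd 1" by (simp add: power2_eq_square algebra_simps)
    then show False using q by (simp add: prime_gt_1_nat)
  qed
  have w3: "[w ^ 3 = 1] (mod int q)"
  proof -
    have "w ^ 3 - 1 = (w - 1) * (w\<^sup>2 + w + 1)" by (simp add: power2_eq_square power3_eq_cube algebra_simps)
    then have "int q dvd w ^ 3 - 1" using w by (auto simp: cong_0_iff)
    then show ?thesis by (simp add: cong_iff_dvd_diff)
  qed
  have fermat: "[w ^ (q - 1) = 1] (mod int q)"
  proof -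
    define x where "x = nat (w mod int q)"
    have q0: "int q > 0" using q prime_gt_0_nat by simp
    then have x: "int x = w mod int q" by (simp add: x_def)
    have "\<not> q dvd x"
    proof
      assume "q dvd x"
      then have "int q dvd w mod int q" using x by (metis int_dvd_int_iff)
      then show False using ndvd by (simp add: dvd_mod_iff)
    qed
    then have "[x ^ (q - 1) = 1] (mod q)" using q fermat_theorem by blast
    then have "[int (x ^ (q - 1)) = int 1] (mod int q)" by (simp only: cong_int_iff)
    then have "[(int x) ^ (q - 1) = 1] (mod int q)" by simp
    moreover have "[int x = w] (mod int q)" by (simp add: x)
    ultimately show ?thesis by (metis cong_pow cong_sym cong_trans)
  qed
  have w1: "\<not> [w = 1] (mod int q)"
  proof
    assume "[w = 1] (mod int q)"
    then have "[w\<^sup>2 + w + 1 = 1\<^sup>2 + 1 + 1] (mod int q)" by (intro cong_add cong_pow) auto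
    then have "[0 = 3] (mod int q)" using w by (simp add: cong_def)
    then have "int q dvd 3" by (simp add: cong_iff_dvd_diff)
    then have "q dvd 3" by presburger
    moreover have "prime (3::nat)" by simp
    ultimately show False using q q3 primes_dvd_imp_eq by blast
  qed
  have "q mod 3 \<noteq> 2"
  proof
    assume "q mod 3 = 2"
    \<comment> \<open>Since \<open>w\<close> has cube 1, its power with exponent q - 1 is
      \<open>w\<close> itself, and Fermat would make \<open>w\<close> congruent to 1.\<close>
    then have "q - 1 = 3 * (q div 3) + 1" by presburger
    then have "w ^ (q - 1) = (w ^ 3) ^ (q div 3) * w" by (simp add: power_mult power_add)
    also have "[\<dots> = 1 ^ (q div 3) * w] (mod int q)" using w3 by (intro cong_mult cong_pow) auto
    finally have "[w ^ (q - 1) = w] (mod int q)" by simp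
    then show False using w1 fermat by (metis cong_sym cong_trans)
  qed
  moreover have "q mod 3 \<noteq> 0"
    using q q3 by (metis dvd_eq_mod_eq_0 prime_nat_iff numeral_eq_one_iff semiring_norm(86))
  moreover have "odd q" using q q2 by (metis prime_odd_nat prime_ge_2_nat le_neq_implies_less)
  ultimately show ?thesis by (simp add: cong_def) presburger
qed

text \<open>A primitive root raised to the power (p - 1) / 3 has cube 1 without being 1, so it is a
  root of the other factor of w^3 - 1.\<close>

lemma obtain_nontrivial_cube_root:
  fixes p :: nat
  assumes p: "prime p" and p6: "[p = 1] (mod 6)"
  obtains w :: int where "[w\<^sup>2 + w + 1 = 0] (mod int p)"
proof -
  obtain g where g: "residue_primroot p g" using prime_primitive_root_exists[OF prime_gt_1_nat[OF p] p] ..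
  then have ord: "ord p g = p - 1" using p by (simp add: residue_primroot_def totient_prime)
  define k where "k = (p - 1) div 3"
  have p7: "p > 1" using p prime_gt_1_nat by blast
  have k: "p - 1 = 3 * k" "k > 0"
    using p6 p7 unfolding k_def cong_def by presburger+
  define w where "w = int (g ^ k)"
  have "[g ^ (3 * k) = 1] (mod p)" using ord_divides[of g "3 * k" p] ord k(1) by simp
  then have "[int (g ^ (3 * k)) = int 1] (mod int p)" by (simp only: cong_int_iff)
  then have "[w ^ 3 = 1] (mod int p)" by (simp add: w_def power_mult mult.commute flip: power_mult)
  then have "int p dvd w ^ 3 - 1" by (simp add: cong_iff_dvd_diff)
  moreover have "w ^ 3 - 1 = (w - 1) * (w\<^sup>2 + w + 1)" by (simp add: power2_eq_square power3_eq_cube algebra_simps)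
  ultimately have "int p dvd (w - 1) * (w\<^sup>2 + w + 1)" by simp
  then have "int p dvd w - 1 \<or> int p dvd w\<^sup>2 + w + 1" using p by (simp add: prime_dvd_mult_iff)
  moreover have "\<not> int p dvd w - 1"
  proof
    assume "int p dvd w - 1"
    then have "[int (g ^ k) = int 1] (mod int p)" by (simp add: w_def cong_iff_dvd_diff)
    then have "[g ^ k = 1] (mod p)" by (simp only: cong_int_iff)
    then have "ord p g dvd k" using ord_divides[of g k p] by simp
    then show False using ord k by (metis dvd_imp_le mult_less_cancel2 nat_mult_1 not_le numeral_One numeral_less_iff one_less_numeral_iff semiring_norm(77))
  qed
  ultimately show ?thesis using that by (auto simp: cong_0_iff)
qed

text \<open>Thue's argument: a cube root of unity \<open>w\<close> modulo \<open>p\<close> and the pigeonhole principle give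
  small \<open>u \<equiv> w v\<close>, whose norm is a multiple of \<open>p\<close> below \<open>3 p\<close>.\<close>
lemma prime_eisenstein_norm:
  fixes p :: nat
  assumes p: "prime p" and p6: "[p = 1] (mod 6)"
  obtains u v :: int where "u\<^sup>2 + u * v + v\<^sup>2 = int p"
proof -
  obtain w :: int where w: "[w\<^sup>2 + w + 1 = 0] (mod int p)"
    using obtain_nontrivial_cube_root[OF p p6] .
  have p1: "p > 1" using p prime_gt_1_nat by blast
  \<comment> \<open>The integer part of sqrt p makes the grid \<open>{..m} \<times> {..m}\<close>
    larger than \<open>p\<close>, while differences of coordinates stay below sqrt p.\<close>
  define m where "m = nat \<lfloor>sqrt (real p)\<rfloor>"
  have m_ge: "real p < (real m + 1)\<^sup>2"
  proof -
    have "sqrt (real p) < real m + 1" by (simp add: m_def)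
    then have "(sqrt (real p))\<^sup>2 < (real m + 1)\<^sup>2" by (intro power_strict_mono) auto
    then show ?thesis by simp
  qed
  have m_le: "m\<^sup>2 \<le> p"
  proof -
    have "real m \<le> sqrt (real p)" by (simp add: m_def)
    then have "(real m)\<^sup>2 \<le> (sqrt (real p))\<^sup>2" by (intro power_mono) auto
    then have "real (m\<^sup>2) \<le> real p" by simp
    then show ?thesis by linarith
  qed
  have m_sq: "m\<^sup>2 < p"
  proof -
    have "m\<^sup>2 \<noteq> p" using p by (auto simp: prime_power_iff)
    then show ?thesis using m_le by simp
  qed
  define f :: "nat \<times> nat \<Rightarrow> int" where "f = (\<lambda>(x, y). (int x - w * int y) mod int p)"
  have "f ` ({..m} \<times> {..m}) \<subseteq> {0..<int p}" using p1 by (auto simp: f_def)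
  then have "card (f ` ({..m} \<times> {..m})) \<le> p" using card_mono[of "{0..<int p}"] by fastforce
  moreover have "p < card ({..m} \<times> {..m})"
  proof -
    have "real p < real ((m + 1)\<^sup>2)" using m_ge by (simp add: add.commute)
    then have "p < (m+1)\<^sup>2" by linarith
    then show ?thesis by (simp add: power2_eq_square)
  qed
  ultimately have "\<not> inj_on f ({..m} \<times> {..m})" using pigeonhole[of f "{..m} \<times> {..m}"] by linarith
  then obtain x y x' y' where xy: "x \<le> m" "y \<le> m" "x' \<le> m" "y' \<le> m" "(x, y) \<noteq> (x', y')" "f (x, y) = f (x', y')"
    unfolding inj_on_def by auto
  define u where "u = int x - int x'"
  define v where "v = int y - int y'"
  have uv: "\<bar>u\<bar> \<le> int m" "\<bar>v\<bar> \<le> int m" "u \<noteq> 0 \<or> v \<noteq> 0" using xy by (auto simp: u_def v_def)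
  have "[int x - w * int y = int x' - w * int y'] (mod int p)" using xy(6) by (simp add: f_def cong_def)
  then have "int p dvd u - w * v" by (simp add: cong_iff_dvd_diff u_def v_def algebra_simps)
  \<comment> \<open>Modulo \<open>p\<close> the two roots of T^2 + T + 1 are \<open>w\<close> and
    \<open>- 1 - w\<close>, so u^2 + uv + v^2 is congruent to the product of u - wv and its
    conjugate u + (w + 1)v.\<close>
  then have "int p dvd (u - w * v) * (u + w * v + v) + v\<^sup>2 * (w\<^sup>2 + w + 1)" using w
    by (intro dvd_add) (auto simp: cong_0_iff)
  also have "(u - w * v) * (u + w * v + v) + v\<^sup>2 * (w\<^sup>2 + w + 1) = u\<^sup>2 + u * v + v\<^sup>2"
    by (simp add: power2_eq_square algebra_simps)
  finally obtain t where t: "u\<^sup>2 + u * v + v\<^sup>2 = int p * t" by (auto simp: dvd_def)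
  have pos: "u\<^sup>2 + u * v + v\<^sup>2 > 0"
  proof -
    have "4 * (u\<^sup>2 + u * v + v\<^sup>2) = (2 * u + v)\<^sup>2 + 3 * v\<^sup>2"
      by (simp add: power2_eq_square algebra_simps)
    moreover have "(2 * u + v)\<^sup>2 + 3 * v\<^sup>2 > 0"
      using uv(3) by (cases "v = 0") (simp_all add: add_nonneg_pos)
    ultimately have "0 < 4 * (u\<^sup>2 + u * v + v\<^sup>2)" by (simp only:)
    then show ?thesis by (simp only: zero_less_mult_iff) simp
  qed
  have lt: "u\<^sup>2 + u * v + v\<^sup>2 < 3 * int p"
  proof -
    have "u\<^sup>2 \<le> (int m)\<^sup>2" "v\<^sup>2 \<le> (int m)\<^sup>2" using uv by (simp_all add: abs_le_square_iff[symmetric])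
    moreover have "2 * (u * v) \<le> u\<^sup>2 + v\<^sup>2" using zero_le_power2[of "u - v"] by (simp add: power2_eq_square algebra_simps)
    moreover have "(int m)\<^sup>2 < int p" using m_sq by (metis of_nat_less_iff of_nat_power)
    ultimately show ?thesis by linarith
  qed
  have "t > 0" using pos t p1 by (simp add: zero_less_mult_iff)
  moreover have "t < 3" using lt t p1 by simp
  \<comment> \<open>The form is even only if \<open>u\<close> and \<open>v\<close> both are. It is
    then divisible by 4, and t = 2 would make \<open>p\<close> even.\<close>
  moreover have "t \<noteq> 2"
  proof
    assume t2: "t = 2"
    have "even (u\<^sup>2 + u * v + v\<^sup>2)" using t t2 by simp
    then have "even u" "even v" by auto
    then obtain u' v' where "u = 2 * u'" "v = 2 * v'" by (auto elim!: evenE)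
    then have "2 * (u'\<^sup>2 + u' * v' + v'\<^sup>2) = int p" using t t2 by (simp add: power2_eq_square algebra_simps)
    then have "even (int p)" by (metis dvd_triv_left)
    then have "even p" by simp
    then show False using p6 by (auto simp: cong_def) presburger
  qed
  ultimately have "t = 1" by linarith
  then show ?thesis using that t by simp
qed

text \<open>The solution is the square of an Eisenstein integer of norm \<open>p\<close>, scaled by \<open>m / p\<close>.\<close>
lemma nontrivial_eisenstein_square:
  fixes p :: nat and m :: nat
  assumes p: "prime p" and p6: "[p = 1] (mod 6)" and dvd: "p dvd m" and m: "m > 0"
  obtains x y :: int where "x\<^sup>2 + x * y + y\<^sup>2 = (int m)\<^sup>2" "x \<noteq> 0" "y \<noteq> 0" "x + y \<noteq> 0"
proof -
  obtain u v :: int where uv: "u\<^sup>2 + u * v + v\<^sup>2 = int p"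
    using prime_eisenstein_norm[OF p p6] .
  obtain k where k: "m = p * k" using dvd by (auto simp: dvd_def)
  have k0: "k > 0" using k m by auto
  have pi: "prime (int p)" using p by simp
  have nsq: "int p \<noteq> z\<^sup>2" for z :: int
    using pi by (metis prime_power_iff numeral_eq_one_iff semiring_norm(85))
  have n3: "int p \<noteq> 3 * z\<^sup>2" for z :: int
  proof
    assume "int p = 3 * z\<^sup>2"
    then have "int p mod 3 = 0" by simp
    then have "p mod 3 = 0" by presburger
    then show False using p6 unfolding cong_def by presburger
  qed
  \<comment> \<open>If one of these vanished, \<open>p\<close> would be a square or three times a
    square. The six linear forms are the factors of \<open>x\<close>, \<open>y\<close> and
    \<open>x + y\<close> below.\<close>
  have nz: "u \<noteq> 0" "v \<noteq> 0" "u + v \<noteq> 0" "u - v \<noteq> 0" "2 * u + v \<noteq> 0" "u + 2 * v \<noteq> 0"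
  proof -
    show "u \<noteq> 0" using uv nsq[of v] by auto
    show "v \<noteq> 0" using uv nsq[of u] by auto
    show "u + v \<noteq> 0"
    proof
      assume "u + v = 0"
      then have "v = - u" by simp
      then show False using uv nsq[of u] by (simp add: power2_eq_square)
    qed
    show "u - v \<noteq> 0"
    proof
      assume "u - v = 0"
      then have "v = u" by simp
      then show False using uv n3[of u] by (simp add: power2_eq_square)
    qed
    show "2 * u + v \<noteq> 0"
    proof
      assume "2 * u + v = 0"
      then have "v = - 2 * u" by simp
      then show False using uv n3[of u] by (simp add: power2_eq_square)
    qed
    show "u + 2 * v \<noteq> 0"
    proof
      assume "u + 2 * v = 0"
      then have "u = - 2 * v" by simp
      then show False using uv n3[of v] by (simp add: power2_eq_square)
    qed
  qed
  \<comment> \<open>With \<omega>^2 = - 1 - \<omega>, the square of u - v\<omega> is (u^2 - v^2) -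
    (2uv + v^2)\<omega>.\<close>
  define x y where "x = int k * (u\<^sup>2 - v\<^sup>2)" and "y = int k * (2 * u * v + v\<^sup>2)"
  have "x = int k * ((u - v) * (u + v))" "y = int k * (v * (2 * u + v))" "x + y = int k * (u * (u + 2 * v))"
    by (simp_all add: x_def y_def power2_eq_square algebra_simps)
  then have "x \<noteq> 0" "y \<noteq> 0" "x + y \<noteq> 0" using nz k0 by simp_all
  moreover have "x\<^sup>2 + x * y + y\<^sup>2 = (int k)\<^sup>2 * (u\<^sup>2 + u * v + v\<^sup>2)\<^sup>2"
    by (simp add: x_def y_def power2_eq_square algebra_simps)
  then have "x\<^sup>2 + x * y + y\<^sup>2 = (int m)\<^sup>2"
    by (simp add: uv k power_mult_distrib mult.commute)
  ultimately show ?thesis using that by blast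
qed

text \<open>After division by the gcd, a prime q dividing \<open>m'\<close> makes x'/y' a root of
  T^2 + T + 1 modulo q, so q is 3 or congruent to 1 modulo 6. The prime 3 is excluded because q^2,
  and not only q, divides the norm. Hence m' = 1, and only the six units remain.\<close>

lemma trivial_eisenstein_square:
  fixes m :: nat and x y :: int
  assumes no: "\<not> (\<exists>p::nat. prime p \<and> [p = 1] (mod 6) \<and> p dvd m)"
    and m: "m > 0" and xy: "x\<^sup>2 + x * y + y\<^sup>2 = (int m)\<^sup>2"
  shows "x = 0 \<or> y = 0 \<or> x + y = 0"
proof -
  define g where "g = gcd x y"
  have "\<not> (x = 0 \<and> y = 0)" using xy m by auto
  then have g0: "g > 0" by (simp add: g_def gcd_pos_int)
  obtain x' y' where x': "x = g * x'" and y': "y = g * y'" and cop: "coprime x' y'"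
    using gcd_coprime_exists[of x y] g0 by (metis g_def less_irrefl mult.commute)
  have eq: "(int m)\<^sup>2 = g\<^sup>2 * (x'\<^sup>2 + x' * y' + y'\<^sup>2)"
    unfolding xy[symmetric] x' y' by (simp add: power2_eq_square algebra_simps)
  then have "g\<^sup>2 dvd (int m)\<^sup>2" by simp
  then have "g dvd int m" by simp
  then obtain m' where m': "int m = g * m'" by (auto simp: dvd_def)
  have "g\<^sup>2 * m'\<^sup>2 = g\<^sup>2 * (x'\<^sup>2 + x' * y' + y'\<^sup>2)"
    using eq unfolding m' by (simp add: power_mult_distrib)
  then have eq': "x'\<^sup>2 + x' * y' + y'\<^sup>2 = m'\<^sup>2" using g0 by simp
  have m'0: "m' > 0" using m m' g0 by (metis of_nat_0_less_iff zero_less_mult_pos)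
  have "nat m' = 1"
  proof (rule ccontr)
    assume "nat m' \<noteq> 1"
    then obtain q where q: "prime q" "q dvd nat m'" using prime_factor_nat by blast
    have qm: "int q dvd m'" using q(2) m'0 by (metis int_dvd_int_iff int_nat_eq less_imp_le)
    have qi: "prime (int q)" using q by simp
    have q2: "(int q)\<^sup>2 dvd x'\<^sup>2 + x' * y' + y'\<^sup>2" unfolding eq' using qm by simp
    have qn: "int q dvd x'\<^sup>2 + x' * y' + y'\<^sup>2" unfolding eq' using qm by (simp add: dvd_power_iff power2_eq_square)
    have ny: "\<not> int q dvd y'"
    proof
      assume y: "int q dvd y'"
      then have "int q dvd (x'\<^sup>2 + x' * y' + y'\<^sup>2) - y' * (x' + y')" using qn by (intro dvd_diff dvd_mult2)
      then have "int q dvd x'\<^sup>2" by (simp add: power2_eq_square algebra_simps)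
      then have "int q dvd x'" using qi prime_dvd_power by blast
      then show False using y cop qi by (meson coprime_common_divisor not_prime_unit)
    qed
    have "coprime y' (int q)" using ny qi by (metis prime_imp_coprime coprime_commute)
    \<comment> \<open>\<open>z\<close> inverts \<open>y'\<close> modulo \<open>q\<close>, so
      \<open>x' * z\<close> plays the role of x'/y'.\<close>
    then obtain z where z: "[y' * z = 1] (mod int q)" using cong_solve_coprime_int by blast
    have "[(x' * z)\<^sup>2 + (x' * z) + 1 = (x' * z)\<^sup>2 + (x' * z) * (y' * z) + (y' * z)\<^sup>2] (mod int q)"
    proof (intro cong_add)
      show "[x' * z = x' * z * (y' * z)] (mod int q)" using cong_scalar_left[OF z, of "x' * z"] cong_sym by fastforce
      show "[1 = (y' * z)\<^sup>2] (mod int q)" using cong_pow[OF z, of 2] cong_sym by fastforce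
    qed simp
    also have "(x' * z)\<^sup>2 + (x' * z) * (y' * z) + (y' * z)\<^sup>2 = z\<^sup>2 * (x'\<^sup>2 + x' * y' + y'\<^sup>2)"
      by (simp add: power2_eq_square algebra_simps)
    also have "[\<dots> = 0] (mod int q)" using qn by (simp add: cong_0_iff)
    finally have w: "[(x' * z)\<^sup>2 + (x' * z) + 1 = 0] (mod int q)" .
    have "q \<noteq> 3"
    proof
      assume q3: "q = 3"
      have "3 dvd x'\<^sup>2 + x' * y' + y'\<^sup>2" using qn q3 by simp
      then have "3 dvd (x'\<^sup>2 + x' * y' + y'\<^sup>2) - 3 * (x' * y')" by (intro dvd_diff) auto
      then have "3 dvd (x' - y')\<^sup>2" by (simp add: power2_eq_square algebra_simps)
      then have "3 dvd x' - y'" using prime_dvd_power[of "3::int"] by simp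
      then obtain t where "x' - y' = 3 * t" by (auto simp: dvd_def)
      \<comment> \<open>The norm becomes 3 y'^2 + 9 (t y' + t^2), so divisibility by 9 forces 3 to
        divide \<open>y'\<close>.\<close>
      then have t: "x' = y' + 3 * t" by simp
      have "9 dvd x'\<^sup>2 + x' * y' + y'\<^sup>2" using q2 q3 by simp
      then have "9 dvd x'\<^sup>2 + x' * y' + y'\<^sup>2 - 9 * (t * y' + t\<^sup>2)" by (intro dvd_diff) auto
      then have "3 * 3 dvd 3 * y'\<^sup>2" by (simp add: t power2_eq_square algebra_simps)
      then have "3 dvd y'\<^sup>2" by (simp only: dvd_mult_cancel_left)  simp
      then have "3 dvd y'" using prime_dvd_power[of "3::int"] by simp
      then show False using ny q3 by simp
    qed
    from prime_imp_cong_1_mod_6[OF q(1) w this] have "[q = 1] (mod 6)" .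
    moreover have "int q dvd int m" using qm m' by simp
    then have "q dvd m" by simp
    ultimately show False using no q(1) by blast
  qed
  then have "m' = 1" by simp
  then have "(2 * x' + y')\<^sup>2 + 3 * y'\<^sup>2 = 4" using eq' by (simp add: power2_eq_square algebra_simps)
  moreover have "(2 * x' + y')\<^sup>2 \<ge> 0" by simp
  ultimately have "y'\<^sup>2 \<le> 1" by linarith
  then have "\<bar>y'\<bar> \<le> 1" by (simp add: abs_square_le_1)
  then consider "y' = 0" | "y' = 1" | "y' = -1" by linarith
  then have "x' = 0 \<or> y' = 0 \<or> x' + y' = 0"
  proof cases
    case 2
    then have "x' * (x' + 1) = 0" using eq' \<open>m' = 1\<close> by (simp add: power2_eq_square algebra_simps)
    then show ?thesis using 2 by auto
  next
    case 3
    then have "x' * (x' - 1) = 0" using eq' \<open>m' = 1\<close> by (simp add: power2_eq_square algebra_simps)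
    then show ?thesis using 3 by auto
  qed auto
  then show ?thesis by (auto simp: x' y' simp flip: distrib_left)
qed

section \<open>Hermitian matrices with two nonzero eigenvalues\<close>

definition mat_trace :: "'a :: comm_ring_1 mat \<Rightarrow> 'a" where
  "mat_trace A = (\<Sum>i<dim_row A. A $$ (i, i))"

lemma index_mult_mat_sum:
  assumes "A \<in> carrier_mat n m" "B \<in> carrier_mat m p" "i < n" "j < p"
  shows "(A * B) $$ (i, j) = (\<Sum>k<m. A $$ (i, k) * B $$ (k, j))"
  using assms by (auto simp: scalar_prod_def atLeast0LessThan intro!: sum.cong)

lemma mat_trace_mult:
  assumes "A \<in> carrier_mat n m" "B \<in> carrier_mat m n"
  shows "mat_trace (A * B) = (\<Sum>i<n. \<Sum>k<m. A $$ (i, k) * B $$ (k, i))"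
  using assms by (simp add: mat_trace_def index_mult_mat_sum[OF assms] del: index_mult_mat(1))

lemma mat_trace_mult_commute:
  assumes "A \<in> carrier_mat n m" "B \<in> carrier_mat m n"
  shows "mat_trace (A * B) = mat_trace (B * A)"
  unfolding mat_trace_mult[OF assms] mat_trace_mult[OF assms(2,1)]
  by (subst sum.swap) (simp add: mult.commute)

lemma mat_trace_add:
  assumes "A \<in> carrier_mat n n" "B \<in> carrier_mat n n"
  shows "mat_trace (A + B) = mat_trace A + mat_trace B"
  using assms by (auto simp: mat_trace_def sum.distrib)

lemma mat_trace_smult:
  assumes "A \<in> carrier_mat n n"
  shows "mat_trace (c \<cdot>\<^sub>m A) = c * mat_trace A"
  using assms by (auto simp: mat_trace_def sum_distrib_left)

lemma smult_smult_mat: "a \<cdot>\<^sub>m (b \<cdot>\<^sub>m A) = (a * b :: 'a :: comm_ring_1) \<cdot>\<^sub>m A"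
  by (rule eq_matI) (auto simp: mult.assoc)

lemma mat_trace_similar:
  assumes "similar_mat_wit A B P Q"
  shows "mat_trace A = mat_trace B"
proof -
  define n where "n = dim_row A"
  note w = similar_mat_witD[OF n_def assms]
  have "mat_trace A = mat_trace ((P * B) * Q)" using w(3) by simp
  also have "\<dots> = mat_trace (Q * (P * B))" using w by (intro mat_trace_mult_commute[of _ n n]) auto
  also have "Q * (P * B) = (Q * P) * B" using w by (intro assoc_mult_mat[symmetric, of _ n n _ n _ n]) auto
  also have "\<dots> = B" using w by simp
  finally show ?thesis .
qed

lemma upper_triangular_mult:
  assumes A: "A \<in> carrier_mat n n" "upper_triangular A" and B: "B \<in> carrier_mat n n" "upper_triangular B"
  shows "upper_triangular (A * B)" and "i < n \<Longrightarrow> (A * B) $$ (i, i) = A $$ (i, i) * B $$ (i, i)"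
proof -
  show "upper_triangular (A * B)"
  proof (rule upper_triangularI)
    fix i j assume ij: "j < i" "i < dim_row (A * B)"
    then have "(A * B) $$ (i, j) = (\<Sum>k<n. A $$ (i, k) * B $$ (k, j))"
      using A B by (intro index_mult_mat_sum[of _ n n _ n]) auto
    also have "\<dots> = 0"
    proof (rule sum.neutral, safe)
      fix k assume "k < n"
      show "A $$ (i, k) * B $$ (k, j) = 0"
      proof (cases "k < i")
        case True
        then have "A $$ (i, k) = 0"
          using A ij by (intro upper_triangularD[of A]) auto
        then show ?thesis by simp
      next
        case False
        then have "B $$ (k, j) = 0"
          using B ij \<open>k < n\<close> by (intro upper_triangularD[of B]) auto
        then show ?thesis by simp
      qed
    qed
    finally show "(A * B) $$ (i, j) = 0" .
  qed
next
  assume i: "i < n"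
  then have "(A * B) $$ (i, i) = (\<Sum>k<n. A $$ (i, k) * B $$ (k, i))"
    using A B by (intro index_mult_mat_sum) auto
  also have "\<dots> = (\<Sum>k\<in>{i}. A $$ (i, k) * B $$ (k, i))"
  proof (rule sum.mono_neutral_right)
    show "\<forall>k\<in>{..<n} - {i}. A $$ (i, k) * B $$ (k, i) = 0"
    proof
      fix k assume k: "k \<in> {..<n} - {i}"
      then consider "k < i" | "k > i" by fastforce
      then show "A $$ (i, k) * B $$ (k, i) = 0"
        using upper_triangularD[OF A(2)] upper_triangularD[OF B(2)] A(1) B(1) i k by cases auto
    qed
  qed (use i in auto)
  finally show "(A * B) $$ (i, i) = A $$ (i, i) * B $$ (i, i)" by simp
qed

lemma upper_triangular_pow:
  fixes A :: "'a :: comm_ring_1 mat"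
  assumes A: "A \<in> carrier_mat n n" "upper_triangular A"
  shows "upper_triangular (A ^\<^sub>m k) \<and> (\<forall>i<n. (A ^\<^sub>m k) $$ (i, i) = A $$ (i, i) ^ k)"
proof (induction k)
  case 0
  then show ?case using A by auto
next
  case (Suc k)
  then show ?case using upper_triangular_mult[of "A ^\<^sub>m k" n A] A
    by (auto simp: mult_ac simp del: index_mult_mat(1))
qed

text \<open>A Schur form has the eigenvalues on its diagonal and its powers have their powers there,
  so power sums are traces without any diagonalisation.\<close>

lemma mat_trace_pow_char_poly:
  assumes A: "(A :: complex mat) \<in> carrier_mat n n"
    and es: "char_poly A = (\<Prod>e\<leftarrow>es. [:- e, 1:])"
  shows "mat_trace (A ^\<^sub>m k) = (\<Sum>e\<leftarrow>es. e ^ k)"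
proof -
  obtain B P Q where "schur_decomposition A es = (B, P, Q)" by (metis prod_cases3)
  from schur_decomposition[OF A es this]
  have w: "similar_mat_wit A B P Q" and B: "upper_triangular B" "diag_mat B = es" by auto
  have Bn: "B \<in> carrier_mat n n" using similar_mat_witD2[OF A w] by auto
  have "mat_trace (A ^\<^sub>m k) = mat_trace (B ^\<^sub>m k)"
    using mat_trace_similar[OF similar_mat_wit_pow[OF w]] .
  also have "\<dots> = (\<Sum>i<n. B $$ (i, i) ^ k)"
    using upper_triangular_pow[OF Bn B(1), of k] Bn by (auto simp: mat_trace_def)
  also have "\<dots> = (\<Sum>e\<leftarrow>diag_mat B. e ^ k)"
    using Bn by (simp add: diag_mat_def o_def interv_sum_list_conv_sum_set_nat atLeast0LessThan)
  finally show ?thesis by (simp add: B)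
qed

lemma char_poly_eq_prod_roots:
  assumes A: "(A :: complex mat) \<in> carrier_mat n n" and es: "mset es = proots (char_poly A)"
  shows "char_poly A = (\<Prod>e\<leftarrow>es. [:- e, 1:])" and "length es = n"
proof -
  have "lead_coeff (char_poly A) = 1" "degree (char_poly A) = n"
    using degree_monic_char_poly[OF A] by auto
  then have "char_poly A = (\<Prod>x\<in>#mset es. [:- x, 1:])"
    using complex_poly_decompose_multiset[of "char_poly A"] es by simp
  then show "char_poly A = (\<Prod>e\<leftarrow>es. [:- e, 1:])"
    by (metis mset_map prod_mset_prod_list)
  show "length es = n" using size_proots_complex[of "char_poly A"] es \<open>degree _ = n\<close>
    by (metis size_mset)
qed

lemma pow_mat_add:
  fixes A :: "'a :: semiring_1 mat"
  assumes A: "A \<in> carrier_mat n n"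
  shows "A ^\<^sub>m (k + l) = A ^\<^sub>m k * A ^\<^sub>m l"
proof (induction l)
  case (Suc l)
  then show ?case using A by (simp add: assoc_mult_mat[of _ n n _ n _ n])
qed (use A in auto)

lemma similar_mat_wit_cubic:
  fixes A :: "'a :: comm_ring_1 mat"
  assumes w: "similar_mat_wit A B P Q" and A: "A ^\<^sub>m 3 = c \<cdot>\<^sub>m A"
  shows "B ^\<^sub>m 3 = c \<cdot>\<^sub>m B"
proof -
  have w': "similar_mat_wit B A Q P" by (rule similar_mat_wit_sym[OF w])
  have "B ^\<^sub>m 3 = Q * A ^\<^sub>m 3 * P" by (rule similar_mat_wit_pow_id[OF w'])
  also have "\<dots> = c \<cdot>\<^sub>m B"
    using similar_mat_wit_smult[OF w', of c] unfolding A similar_mat_wit_def Let_def by simp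
  finally show ?thesis .
qed

lemma list_pm_counts:
  fixes r :: complex
  assumes "set es \<subseteq> {0, r, -r}" "r \<noteq> 0"
  shows "mset es = replicate_mset (count (mset es) r) r + replicate_mset (count (mset es) (-r)) (-r)
           + replicate_mset (count (mset es) 0) 0"
    and "sum_list es = (of_nat (count (mset es) r) - of_nat (count (mset es) (-r))) * r"
    and "(\<Sum>e\<leftarrow>es. e\<^sup>2) = of_nat (count (mset es) r + count (mset es) (-r)) * r\<^sup>2"
  using assms(1)
proof (induction es)
  case (Cons e es)
  {
    case 1
    then show ?case using Cons.IH assms(2) by auto
  next
    case 2
    then show ?case using Cons.IH assms(2) by (auto simp: algebra_simps)
  next
    case 3
    then show ?case using Cons.IH assms(2) by (auto simp: algebra_simps)
  }
qed auto

text \<open>The cubic identity passes to the diagonal of a Schur form and confines the eigenvalues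
  to 0, r and -r. The trace makes the multiplicities of r and -r equal, and the trace of the square
  makes their sum 2.\<close>

lemma proots_char_poly_rank_two:
  assumes A: "(A :: complex mat) \<in> carrier_mat n n" and r: "r \<noteq> 0"
    and cub: "A ^\<^sub>m 3 = r\<^sup>2 \<cdot>\<^sub>m A" and tr: "mat_trace A = 0" "mat_trace (A ^\<^sub>m 2) = 2 * r\<^sup>2"
  shows "proots (char_poly A) = {#r, - r#} + replicate_mset (n - 2) 0"
proof -
  obtain es where es: "mset es = proots (char_poly A)" using ex_mset by blast
  note cp = char_poly_eq_prod_roots[OF A es]
  obtain B P Q where "schur_decomposition A es = (B, P, Q)" by (metis prod_cases3)
  from schur_decomposition[OF A cp(1) this]
  have w: "similar_mat_wit A B P Q" and B: "upper_triangular B" "diag_mat B = es" by auto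
  have Bn: "B \<in> carrier_mat n n" using similar_mat_witD2[OF A w] by auto
  have B3: "B ^\<^sub>m 3 = r\<^sup>2 \<cdot>\<^sub>m B" by (rule similar_mat_wit_cubic[OF w cub])
  have "set es \<subseteq> {0, r, -r}"
  proof
    fix e assume "e \<in> set es"
    then obtain i where i: "i < n" "e = B $$ (i, i)" using B(2) Bn by (auto simp: diag_mat_def)
    then have "e ^ 3 = r\<^sup>2 * e" using upper_triangular_pow[OF Bn B(1), of 3] B3 Bn by auto
    then have "e * (e - r) * (e + r) = 0" by (simp add: power2_eq_square power3_eq_cube algebra_simps)
    then show "e \<in> {0, r, -r}" by (auto simp: add_eq_0_iff)
  qed
  note cnt = list_pm_counts[OF this r]
  define a b where "a = count (mset es) r" and "b = count (mset es) (-r)"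
  have "A ^\<^sub>m 1 = A" using A by auto
  then have "sum_list es = 0" "(\<Sum>e\<leftarrow>es. e\<^sup>2) = 2 * r\<^sup>2"
    using mat_trace_pow_char_poly[OF A cp(1), of 1] mat_trace_pow_char_poly[OF A cp(1), of 2] tr by auto
  then have "of_nat a = (of_nat b :: complex)" "of_nat (a + b) = (2 :: complex)"
    using cnt(2,3) r by (auto simp: a_def b_def)
  then have "a = b" "a + b = 2"
    by (simp, metis of_nat_eq_iff of_nat_numeral)
  then have ab: "a = 1" "b = 1" by auto
  have "size (mset es) = n" using cp(2) by simp
  then have "count (mset es) 0 = n - 2"
    using arg_cong[OF cnt(1), of size] ab by (simp add: a_def[symmetric] b_def[symmetric])
  then have "mset es = replicate_mset a r + replicate_mset b (- r) + replicate_mset (n - 2) 0"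
    using cnt(1) unfolding a_def b_def by simp
  then show ?thesis using ab es by simp
qed

section \<open>From two nonzero eigenvalues to rank two\<close>

lemma index_cube_mat:
  assumes A: "A \<in> carrier_mat n n" and "i < n" "j < n"
  shows "(A ^\<^sub>m 3) $$ (i, j) = (\<Sum>k<n. \<Sum>l<n. A $$ (i, k) * A $$ (k, l) * A $$ (l, j))"
proof -
  have "A ^\<^sub>m 3 = A * (A * A)"
    using A by (simp add: numeral_3_eq_3 assoc_mult_mat[of _ n n _ n _ n])
  also have "\<dots> $$ (i, j) = (\<Sum>k<n. A $$ (i, k) * (\<Sum>l<n. A $$ (k, l) * A $$ (l, j)))"
    using assms by (simp add: index_mult_mat_sum[of _ n n _ n] del: index_mult_mat(1))
  finally show ?thesis by (simp add: sum_distrib_left mult.assoc)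
qed

text \<open>For Hermitian \<open>X\<close> this trace is the sum of the squared moduli of all
  entries.\<close>

lemma hermitian_trace_zero:
  assumes X: "(X :: complex mat) \<in> carrier_mat n n" and h: "\<And>i j. i < n \<Longrightarrow> j < n \<Longrightarrow> X $$ (j, i) = cnj (X $$ (i, j))"
    and tr: "mat_trace (X * X) = 0"
  shows "X = 0\<^sub>m n n"
proof -
  have "mat_trace (X * X) = (\<Sum>i<n. \<Sum>k<n. of_real ((cmod (X $$ (i, k)))\<^sup>2))"
    unfolding mat_trace_mult[OF X X] complex_norm_square
    by (intro sum.cong refl) (metis h lessThan_iff)
  then have "of_real (\<Sum>i<n. \<Sum>k<n. (cmod (X $$ (i, k)))\<^sup>2) = (0::complex)" using tr by simp
  then have "(\<Sum>i<n. \<Sum>k<n. (cmod (X $$ (i, k)))\<^sup>2) = 0" by (simp only: of_real_eq_0_iff)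
  then have "\<forall>i<n. \<forall>k<n. X $$ (i, k) = 0"
    by (simp add: sum_nonneg_eq_0_iff sum_nonneg)
  then show ?thesis using X by auto
qed

text \<open>The power sums of the eigenvalues give \<open>A\<^sup>3 - r\<^sup>2 A\<close>, a Hermitian matrix, a square of trace zero;
  this replaces a diagonalisation of \<open>A\<close>.\<close>
lemma hermitian_two_eigenvalues_cubic:
  assumes A: "(A :: complex mat) \<in> carrier_mat n n"
    and h: "\<And>i j. i < n \<Longrightarrow> j < n \<Longrightarrow> A $$ (j, i) = cnj (A $$ (i, j))"
    and r: "r \<in> \<real>"
    and cp: "char_poly A = (\<Prod>e\<leftarrow>[r, - r] @ replicate m 0. [:- e, 1:])"
  shows "A ^\<^sub>m 3 = r\<^sup>2 \<cdot>\<^sub>m A"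
proof -
  define X where "X = A ^\<^sub>m 3 + (- r\<^sup>2) \<cdot>\<^sub>m A"
  have [simp]: "A ^\<^sub>m k \<in> carrier_mat n n" for k using A by auto
  have Xn: "X \<in> carrier_mat n n" using A by (auto simp: X_def)
  \<comment> \<open>Only for positive \<open>k\<close>: each eigenvalue zero contributes 0^0 = 1 to
    the power sum of exponent 0.\<close>
  have tr: "mat_trace (A ^\<^sub>m k) = r ^ k + (-r) ^ k" if "k > 0" for k
    using that unfolding mat_trace_pow_char_poly[OF A cp] by (simp add: sum_list_replicate)
  have p: "A ^\<^sub>m 3 * A ^\<^sub>m 3 = A ^\<^sub>m 6" "A ^\<^sub>m 3 * A = A ^\<^sub>m 4" "A * A ^\<^sub>m 3 = A ^\<^sub>m 4" "A * A = A ^\<^sub>m 2"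
    using pow_mat_add[OF A, of 3 3] pow_mat_add[OF A, of 3 1] pow_mat_add[OF A, of 1 3] pow_mat_add[OF A, of 1 1] A
    by (auto simp: numeral_eq_Suc)
  have "X * X = (A ^\<^sub>m 6 + (- r\<^sup>2) \<cdot>\<^sub>m A ^\<^sub>m 4) + ((- r\<^sup>2) \<cdot>\<^sub>m A ^\<^sub>m 4 + (r ^ 4) \<cdot>\<^sub>m A ^\<^sub>m 2)"
    unfolding X_def using A
    by (simp add: add_mult_distrib_mat[of _ n n _ _ n] mult_add_distrib_mat[of _ n n _ n] p
        mult_smult_assoc_mat[of _ n n _ n] mult_smult_distrib[of _ n n _ n] add_smult_distrib_left_mat[of _ n n] smult_smult_mat flip: power_add)
  \<comment> \<open>An eigenvalue e of \<open>A\<close> contributes e^2 (e^2 - r^2)^2, which is zero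
    for e = r, -r and 0.\<close>
  then have "mat_trace (X * X) = 0"
    using A by (simp add: mat_trace_add[of _ n] mat_trace_smult[of _ n] tr flip: power_add)
  moreover have "X $$ (j, i) = cnj (X $$ (i, j))" if ij: "i < n" "j < n" for i j
  proof -
    have "cnj ((A ^\<^sub>m 3) $$ (i, j)) = (\<Sum>k<n. \<Sum>l<n. cnj (A $$ (i, k)) * cnj (A $$ (k, l)) * cnj (A $$ (l, j)))"
      unfolding index_cube_mat[OF A ij] by simp
    also have "\<dots> = (\<Sum>k<n. \<Sum>l<n. A $$ (j, l) * A $$ (l, k) * A $$ (k, i))"
    proof (intro sum.cong refl)
      fix k l assume "k \<in> {..<n}" "l \<in> {..<n}"
      then show "cnj (A $$ (i, k)) * cnj (A $$ (k, l)) * cnj (A $$ (l, j)) = A $$ (j, l) * A $$ (l, k) * A $$ (k, i)"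
        using h[of i k] h[of k l] h[of l j] ij by simp
    qed
    also have "\<dots> = (A ^\<^sub>m 3) $$ (j, i)"
      unfolding index_cube_mat[OF A ij(2,1)] by (rule sum.swap)
    finally have "(A ^\<^sub>m 3) $$ (j, i) = cnj ((A ^\<^sub>m 3) $$ (i, j))" by simp
    moreover have "cnj r = r" using r by (simp add: Reals_cnj_iff)
    ultimately show ?thesis using ij A h[OF ij] by (simp add: X_def pow_carrier_mat)
  qed
  ultimately have X0: "X = 0\<^sub>m n n" by (intro hermitian_trace_zero[OF Xn])
  show ?thesis
  proof (rule eq_matI)
    fix i j assume "i < dim_row (r\<^sup>2 \<cdot>\<^sub>m A)" "j < dim_col (r\<^sup>2 \<cdot>\<^sub>m A)"
    then have ij: "i < n" "j < n" using A by auto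
    have "X $$ (i, j) = 0" using X0 ij by simp
    moreover have "X $$ (i, j) = (A ^\<^sub>m 3) $$ (i, j) - r\<^sup>2 * A $$ (i, j)"
      using ij A unfolding X_def by (subst index_add_mat) auto
    ultimately show "(A ^\<^sub>m 3) $$ (i, j) = (r\<^sup>2 \<cdot>\<^sub>m A) $$ (i, j)" using ij A by simp
  qed (use A in auto)
qed

text \<open>The block of \<open>B\<close> from index \<open>m\<close> on is strictly upper
  triangular, hence nilpotent, and B^3 = cB with c nonzero leaves only the zero block. In entries:
  \<open>B ^\<^sub>m 3\<close> at (i, j) sums over walks i, k, l, j, each of which meets a zero
  diagonal entry, an entry below the diagonal, or an entry of row i closer to the diagonal.\<close>

lemma upper_triangular_cubic_rows_zero:
  assumes B: "(B :: complex mat) \<in> carrier_mat n n" "upper_triangular B"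
    and c: "c \<noteq> 0" "B ^\<^sub>m 3 = c \<cdot>\<^sub>m B"
    and diag: "\<And>i. m \<le> i \<Longrightarrow> i < n \<Longrightarrow> B $$ (i, i) = 0"
    and i: "m \<le> i"
  shows "i < n \<Longrightarrow> j < n \<Longrightarrow> B $$ (i, j) = 0"
proof (induction "j - i" arbitrary: j rule: less_induct)
  case less
  have low: "B $$ (k, l) = 0" if "k < n" "l < k" for k l using B that by auto
  have "(B ^\<^sub>m 3) $$ (i, j) = (\<Sum>k<n. \<Sum>l<n. B $$ (i, k) * B $$ (k, l) * B $$ (l, j))"
    by (rule index_cube_mat) (use B less.prems in auto)
  also have "\<dots> = 0"
  proof (intro sum.neutral ballI)
    fix k l assume "k \<in> {..<n}" "l \<in> {..<n}"
    then have kl: "k < n" "l < n" by auto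
    consider "k < i" | "k = i" | "i < k" "k < j" | "i < k" "j \<le> k" by linarith
    then show "B $$ (i, k) * B $$ (k, l) * B $$ (l, j) = 0"
    proof cases
      case 1 then show ?thesis using low less.prems by simp
    next
      case 2 then show ?thesis using diag i less.prems by simp
    next
      \<comment> \<open>The only use of the induction hypothesis: column \<open>k\<close> lies
        nearer to the diagonal than column \<open>j\<close>.\<close>
      case 3 then show ?thesis using less.hyps[of k] less.prems kl by simp
    next
      case 4
      moreover have "m \<le> k" "m \<le> l" if "k \<le> l" using 4 i that by auto
      ultimately have "B $$ (k, l) = 0 \<or> B $$ (l, j) = 0"
        using low[of k l] low[of l j] diag[of l] kl
        by (cases "l < k"; cases "j < l"; cases "j = l"; cases "k = l") auto
      then show ?thesis by auto
    qed
  qed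
  finally show ?case using c less.prems B by simp
qed

lemma mat_trace_square_two_eigenvalues:
  assumes A: "(A :: complex mat) \<in> carrier_mat n n"
    and roots: "proots (char_poly A) = {#r, - r#} + replicate_mset m 0"
  shows "mat_trace (A ^\<^sub>m 2) = 2 * r\<^sup>2"
proof -
  have "mset ([r, - r] @ replicate m 0) = proots (char_poly A)" by (simp add: roots)
  from mat_trace_pow_char_poly[OF A char_poly_eq_prod_roots(1)[OF A this]] show ?thesis
    by (simp add: sum_list_replicate)
qed

text \<open>The Schur form \<open>B\<close> lists the eigenvalues in the order of \<open>es\<close>.
  With r and -r in front, only the first two rows of \<open>B\<close> survive, so A = P (B Q) is a
  sum of two outer products.\<close>

lemma hermitian_two_eigenvalues_rank_two:
  assumes A: "(A :: complex mat) \<in> carrier_mat n n"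
    and h: "\<And>i j. i < n \<Longrightarrow> j < n \<Longrightarrow> A $$ (j, i) = cnj (A $$ (i, j))"
    and r: "r \<in> \<real>" "r \<noteq> 0"
    and roots: "proots (char_poly A) = {#r, - r#} + replicate_mset m 0"
  obtains x y z w where "\<And>k l. k < n \<Longrightarrow> l < n \<Longrightarrow> A $$ (k, l) = x k * y l + z k * w l"
proof -
  define es where "es = [r, - r] @ replicate m 0"
  have es: "mset es = proots (char_poly A)" by (simp add: es_def roots)
  note cp = char_poly_eq_prod_roots[OF A es]
  have n2: "n \<ge> 2" using cp(2) by (simp add: es_def)
  obtain B P Q where "schur_decomposition A es = (B, P, Q)" by (metis prod_cases3)
  from schur_decomposition[OF A cp(1) this]
  have w: "similar_mat_wit A B P Q" and B: "upper_triangular B" "diag_mat B = es" by auto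
  note wD = similar_mat_witD2[OF A w]
  have B3: "B ^\<^sub>m 3 = r\<^sup>2 \<cdot>\<^sub>m B"
    by (rule similar_mat_wit_cubic[OF w hermitian_two_eigenvalues_cubic[OF A h r(1) cp(1)[unfolded es_def]]])
  have diag: "B $$ (i, i) = 0" if "2 \<le> i" "i < n" for i
  proof -
    have "B $$ (i, i) = es ! i" using B(2) wD(5) that by (auto simp: diag_mat_def)
    also have "\<dots> = 0" using that cp(2) by (auto simp: es_def nth_Cons' )
    finally show ?thesis .
  qed
  have rows: "B $$ (i, j) = 0" if "2 \<le> i" "i < n" "j < n" for i j
    by (rule upper_triangular_cubic_rows_zero[OF wD(5) B(1) _ B3 diag]) (use that r in auto)
  have "A $$ (k, l) = P $$ (k, 0) * (B * Q) $$ (0, l) + P $$ (k, 1) * (B * Q) $$ (1, l)" if "k < n" "l < n" for k l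
  proof -
    have "A = P * (B * Q)" using wD by (simp add: assoc_mult_mat[of _ n n _ n _ n])
    then have "A $$ (k, l) = (\<Sum>i<n. P $$ (k, i) * (B * Q) $$ (i, l))"
      using index_mult_mat_sum[of P n n "B * Q" n k l] wD that by simp
    also have "\<dots> = (\<Sum>i\<in>{0, 1}. P $$ (k, i) * (B * Q) $$ (i, l))"
    proof (rule sum.mono_neutral_right)
      show "\<forall>i\<in>{..<n} - {0, 1}. P $$ (k, i) * (B * Q) $$ (i, l) = 0"
        using rows wD that by (auto simp: index_mult_mat_sum[of _ n n _ n] simp del: index_mult_mat(1))
    qed (use n2 in auto)
    finally show ?thesis by simp
  qed
  then show ?thesis
    using that[of "\<lambda>k. P $$ (k, 0)" "\<lambda>l. (B * Q) $$ (0, l)" "\<lambda>k. P $$ (k, 1)" "\<lambda>l. (B * Q) $$ (1, l)"]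
    by simp
qed

lemma hermitian_two_eigenvalues_minor:
  assumes A: "(A :: complex mat) \<in> carrier_mat n n"
    and h: "\<And>i j. i < n \<Longrightarrow> j < n \<Longrightarrow> A $$ (j, i) = cnj (A $$ (i, j))"
    and r: "r \<in> \<real>" "r \<noteq> 0"
    and roots: "proots (char_poly A) = {#r, - r#} + replicate_mset m 0"
    and lt: "i < n" "j < n" "k < n" "l < n"
    and ij: "A $$ (i, i) = 0" "A $$ (j, j) = 0" "A $$ (i, j) * A $$ (j, i) = 1"
  shows "A $$ (k, l) = A $$ (k, j) * A $$ (j, i) * A $$ (i, l) + A $$ (k, i) * A $$ (i, j) * A $$ (j, l)"
proof -
  obtain x y z w where xy: "\<And>k l. k < n \<Longrightarrow> l < n \<Longrightarrow> A $$ (k, l) = x k * y l + z k * w l"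
    using hermitian_two_eigenvalues_rank_two[OF A h r roots] by blast
  \<comment> \<open>Cofactor expansion of the minor with rows i, j, k and columns i, j, l. The zero
    diagonal entries leave -1 as the coefficient of \<open>A $$ (k, l)\<close>.\<close>
  have "A $$ (i, i) * (A $$ (j, j) * A $$ (k, l) - A $$ (j, l) * A $$ (k, j))
      - A $$ (i, j) * (A $$ (j, i) * A $$ (k, l) - A $$ (j, l) * A $$ (k, i))
      + A $$ (i, l) * (A $$ (j, i) * A $$ (k, j) - A $$ (j, j) * A $$ (k, i)) = 0"
    unfolding xy[OF lt(1,2)] xy[OF lt(2,1)] xy[OF lt(3,4)] xy[OF lt(3,2)] xy[OF lt(1,4)]
      xy[OF lt(3,1)] xy[OF lt(2,4)] xy[OF lt(1,1)] xy[OF lt(2,2)]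
    by (simp add: algebra_simps)
  then have "A $$ (i, j) * A $$ (j, i) * A $$ (k, l) = A $$ (k, j) * A $$ (j, i) * A $$ (i, l) + A $$ (k, i) * A $$ (i, j) * A $$ (j, l)"
    unfolding ij(1,2) by (simp add: algebra_simps)
  then show ?thesis using ij(3) by simp
qed

section \<open>Weighted adjacency of rank two\<close>

text \<open>The entry of the matrix between vertices of parts \<open>p\<close> and \<open>q\<close>, the parts being numbered
  0, 1, 2; the number 3 stands for the isolated vertices.\<close>
definition c3_weight :: "nat \<Rightarrow> nat \<Rightarrow> complex" where
  "c3_weight p q = (if (p, q) \<in> {(0, 1), (1, 2), (2, 0)} then \<i>
     else if (q, p) \<in> {(0, 1), (1, 2), (2, 0)} then - \<i> else 0)"

text \<open>All that the combinatorial classification takes from the spectrum is the minor identity,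
  so it is carried out for abstract weights.\<close>

locale rank_two_weights =
  fixes n :: nat and h :: "nat \<Rightarrow> nat \<Rightarrow> complex"
  assumes herm: "\<And>k l. k < n \<Longrightarrow> l < n \<Longrightarrow> h l k = cnj (h k l)"
    and entries: "\<And>k l. k < n \<Longrightarrow> l < n \<Longrightarrow> h k l \<in> {0, 1, \<i>, - \<i>}"
    and diag: "\<And>k. k < n \<Longrightarrow> h k k = 0"
    and minor: "\<And>i j k l. i < n \<Longrightarrow> j < n \<Longrightarrow> k < n \<Longrightarrow> l < n \<Longrightarrow> h i j \<noteq> 0 \<Longrightarrow>
       h k l = h k j * h j i * h i l + h k i * h i j * h j l"
begin

lemma zero_sym: "k < n \<Longrightarrow> l < n \<Longrightarrow> h k l = 0 \<longleftrightarrow> h l k = 0"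
  using herm[of k l] by auto

lemma mult_swap: "k < n \<Longrightarrow> l < n \<Longrightarrow> h k l \<noteq> 0 \<Longrightarrow> h k l * h l k = 1"
  using herm[of k l] entries[of k l] by auto

text \<open>The weight of the closed walk i, j, k, i. Switching does not change it, and it is - \<i>
  on a triangle that runs through the parts 0, 1, 2 of \<open>c3_weight\<close> in this
  order.\<close>

definition tri :: "nat \<Rightarrow> nat \<Rightarrow> nat \<Rightarrow> complex" where
  "tri i j k = h i j * h j k * h k i"

text \<open>At l = k the minor identity says that the weight and its conjugate add up to
  \<open>h k k\<close>, which is zero.\<close>

lemma tri_imaginary:
  assumes "i < n" "j < n" "k < n" "h i j \<noteq> 0" "h i k \<noteq> 0" "h j k \<noteq> 0"
  shows "tri i j k = \<i> \<or> tri i j k = - \<i>"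
proof -
  have "0 = h k j * h j i * h i k + h k i * h i j * h j k"
    using minor[of i j k k] diag[of k] assms by simp
  moreover have "h i j \<in> {1, \<i>, - \<i>}" "h i k \<in> {1, \<i>, - \<i>}" "h j k \<in> {1, \<i>, - \<i>}"
    using entries[of i j] entries[of i k] entries[of j k] assms by auto
  ultimately show ?thesis
    unfolding tri_def using herm[of i j] herm[of i k] herm[of j k] assms by auto
qed

text \<open>With different signs the two terms of the minor identity for \<open>h k l\<close> would
  reinforce each other to modulus 2, but entries have modulus at most 1.\<close>

lemma tri_eq:
  assumes "i < n" "j < n" "k < n" "h i j \<noteq> 0" "h i k \<noteq> 0" "h j k \<noteq> 0"
    and l: "l < n" "h i l \<noteq> 0" "h j l \<noteq> 0"
  shows "tri i j k = tri i j l"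
proof (rule ccontr)
  assume ne: "tri i j k \<noteq> tri i j l"
  \<comment> \<open>The weight of the walk k, i, l, a unit that can be split off from both terms of
    the minor identity.\<close>
  define X where "X = h k i * h i l"
  have nX: "cmod X = 1"
    using entries[of k i] entries[of i l] assms zero_sym[of i k] by (auto simp: X_def norm_mult)
  have u: "h i j * h j i = 1" "h i k * h k i = 1" "h j k * h k j = 1" "h i l * h l i = 1" "h j l * h l j = 1"
    using mult_swap assms by auto
  have ck: "h k j * h j i * h i k = - tri i j k"
    using minor[of i j k k] diag[of k] assms by (simp add: tri_def add_eq_0_iff mult_ac)
  have "h k l = h k j * h j i * h i l + h k i * h i j * h j l"
    using minor[of i j k l] assms by simp
  also have "\<dots> = (tri i j l - tri i j k) * X"
  proof -
    have "h k j * h j i * h i l = (h k j * h j i * h i k) * X"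
    proof -
      have "(h k j * h j i * h i k) * X = (h i k * h k i) * (h k j * h j i * h i l)"
        by (simp add: X_def mult_ac)
      then show ?thesis unfolding u(2) by (metis mult_1)
    qed
    moreover have "h k i * h i j * h j l = tri i j l * X"
    proof -
      have "tri i j l * X = (h i l * h l i) * (h k i * h i j * h j l)"
        by (simp add: X_def tri_def mult_ac)
      then show ?thesis unfolding u(4) by (metis mult_1)
    qed
    ultimately show ?thesis unfolding ck by (simp add: algebra_simps)
  qed
  finally have "cmod (h k l) = cmod (tri i j l - tri i j k)" using nX by (simp add: norm_mult)
  also have "\<dots> = 2"
    using ne tri_imaginary[of i j k] tri_imaginary[of i j l] assms by auto
  finally show False using entries[of k l] assms by auto
qed

text \<open>The part of \<open>k\<close> is read off from its adjacency to the endpoints of the edge \<open>i j\<close>: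
  adjacent to \<open>j\<close> only, to \<open>i\<close> only, to both, to neither.\<close>
lemma weights_of_oriented_edge:
  assumes i: "i < n" and j: "j < n" and ij: "h i j \<noteq> 0"
    and ori: "\<And>k. k < n \<Longrightarrow> h i k \<noteq> 0 \<Longrightarrow> h j k \<noteq> 0 \<Longrightarrow> tri i j k = - \<i>"
  obtains c :: "nat \<Rightarrow> nat" and d :: "nat \<Rightarrow> complex"
  where "\<And>k. k < n \<Longrightarrow> c k \<le> 3" "\<And>k. k < n \<Longrightarrow> d k \<in> {1, -1, \<i>, - \<i>}"
    "\<And>k l. k < n \<Longrightarrow> l < n \<Longrightarrow> h k l = cnj (d k) * c3_weight (c k) (c l) * d l"
proof -
  define c :: "nat \<Rightarrow> nat" where
    "c k = (if h i k = 0 then if h j k = 0 then 3 else 0 else if h j k = 0 then 1 else 2)" for k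
  \<comment> \<open>The claim of the lemma, normalised by d j = 1, leaves no choice: the entries
    \<open>h j k\<close> determine \<open>d\<close> on parts 0 and 2, so d i is
    \<open>\<i> * h j i\<close>, and then the entries \<open>h i k\<close> determine it on part 1.
    Isolated vertices get 1.\<close>
  define d where
    "d k = (if c k = 0 then \<i> * h j k else if c k = 1 then h j i * h i k else if c k = 2 then - \<i> * h j k else 1)" for k
  have ji: "h j i \<noteq> 0" using zero_sym i j ij by simp
  have "d k \<in> {1, -1, \<i>, - \<i>}" if "k < n" for k
    using entries[OF j that] entries[OF i that] entries[OF j i] ji by (auto simp: d_def c_def)
  moreover have "h k l = cnj (d k) * c3_weight (c k) (c l) * d l" if k: "k < n" and l: "l < n" for k l
  proof -
    have m: "h k l = h k j * h j i * h i l + h k i * h i j * h j l" by (rule minor[OF i j k l ij])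
    have cd: "cnj (d k) = (if c k = 0 then - \<i> * h k j else if c k = 1 then h i j * h k i else if c k = 2 then \<i> * h k j else 1)"
      by (simp add: d_def herm[OF j k] herm[OF i k] herm[OF j i])
    have inv_ij: "h i j * h j i = 1" using mult_swap[OF i j ij] .
    \<comment> \<open>At a common neighbour the orientation turns entries at \<open>i\<close> into
      entries at \<open>j\<close>. This makes the two terms of the minor identity cancel when
      \<open>k\<close> and \<open>l\<close> both lie in part 2.\<close>
    have orl: "h j i * h i l = \<i> * h j l" if "h i l \<noteq> 0" "h j l \<noteq> 0"
    proof -
      have "h i j * h j l * h l i = - \<i>" using ori[OF l that] by (simp add: tri_def)
      then have "(h i j * h j l * h l i) * (h j i * h i l) = - \<i> * (h j i * h i l)" by (simp only:)
      then have "(h i j * h j i) * (h i l * h l i) * h j l = - \<i> * (h j i * h i l)" by (simp only: mult_ac)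
      then have "h j l = - \<i> * (h j i * h i l)" using inv_ij mult_swap[OF i l that(1)] by simp
      then show ?thesis by simp
    qed
    have ork: "h k i * h i j = - \<i> * h k j" if "h i k \<noteq> 0" "h j k \<noteq> 0"
    proof -
      have "h i j * h j k * h k i = - \<i>" using ori[OF k that] by (simp add: tri_def)
      then have "(h i j * h j k * h k i) * h k j = - \<i> * h k j" by (simp only:)
      then have "(h j k * h k j) * (h k i * h i j) = - \<i> * h k j" by (simp only: mult_ac)
      then show ?thesis using mult_swap[OF j k that(2)] by (simp add: mult_ac)
    qed
    have z: "h i k = 0 \<Longrightarrow> h k i = 0" "h j k = 0 \<Longrightarrow> h k j = 0" using zero_sym i j k by auto
    have ii: "\<i> * (x * (\<i> * y)) = - (x * y)" for x y :: complex
      by (simp add: mult.left_commute)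
    show ?thesis unfolding cd unfolding d_def m
    proof (cases "h i k = 0"; cases "h j k = 0"; cases "h i l = 0"; cases "h j l = 0")
    qed (auto simp: c_def c3_weight_def z ii orl ork mult.assoc)
  qed
  moreover have "c k \<le> 3" for k by (simp add: c_def)
  ultimately show ?thesis using that by blast
qed

text \<open>By \<open>tri_eq\<close> one triangle on the edge decides the sign of all of them. If it
  is the wrong one, the edge is read from \<open>j\<close> to \<open>i\<close>, which conjugates
  every weight.\<close>

lemma weights_classification:
  assumes "i < n" "j < n" "h i j \<noteq> 0"
  obtains c :: "nat \<Rightarrow> nat" and d :: "nat \<Rightarrow> complex"
  where "\<And>k. k < n \<Longrightarrow> c k \<le> 3" "\<And>k. k < n \<Longrightarrow> d k \<in> {1, -1, \<i>, - \<i>}"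
    "\<And>k l. k < n \<Longrightarrow> l < n \<Longrightarrow> h k l = cnj (d k) * c3_weight (c k) (c l) * d l"
proof (cases "\<exists>k<n. h i k \<noteq> 0 \<and> h j k \<noteq> 0 \<and> tri i j k = \<i>")
  case True
  then obtain k where k: "k < n" "h i k \<noteq> 0" "h j k \<noteq> 0" "tri i j k = \<i>" by blast
  have "tri j i l = - \<i>" if l: "l < n" "h j l \<noteq> 0" "h i l \<noteq> 0" for l
  proof -
    have "tri i j l = \<i>" using tri_eq[of i j k l] assms k l by simp
    moreover have "tri j i l = cnj (tri i j l)"
      using herm[of i j] herm[of j l] herm[of l i] assms l by (simp add: tri_def mult_ac)
    ultimately show ?thesis by simp
  qed
  then show ?thesis using weights_of_oriented_edge[of j i] assms zero_sym that by metis
next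
  case False
  then have "tri i j k = - \<i>" if "k < n" "h i k \<noteq> 0" "h j k \<noteq> 0" for k
    using tri_imaginary[of i j k] assms that by metis
  then show ?thesis using weights_of_oriented_edge[of i j] assms that by metis
qed

end

section \<open>Sums over colour classes\<close>

definition colour_classes :: "nat \<Rightarrow> (nat \<Rightarrow> nat) \<Rightarrow> nat \<Rightarrow> nat \<Rightarrow> nat \<Rightarrow> nat \<Rightarrow> bool" where
  "colour_classes n c p q r t \<longleftrightarrow> (\<forall>k<n. c k \<le> 3) \<and>
     p = card {k. k < n \<and> c k = 0} \<and> q = card {k. k < n \<and> c k = 1} \<and>
     r = card {k. k < n \<and> c k = 2} \<and> t = card {k. k < n \<and> c k = 3}"

text \<open>Collapses sums over vertices to four terms, so that the trace and the cubic identity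
  become finite checks on colours.\<close>

lemma sum_colours:
  fixes F :: "nat \<Rightarrow> 'a :: comm_semiring_1"
  assumes "colour_classes n c p q r t"
  shows "(\<Sum>k<n. F (c k)) = of_nat p * F 0 + of_nat q * F 1 + of_nat r * F 2 + of_nat t * F 3"
proof -
  have "(\<Sum>k<n. F (c k)) = (\<Sum>x\<in>{0, 1, 2, 3}. \<Sum>k\<in>{k \<in> {..<n}. c k = x}. F (c k))"
    by (rule sum.group[symmetric]) (use assms in \<open>auto simp: colour_classes_def\<close>)
  also have "\<dots> = (\<Sum>x\<in>{0, 1, 2, 3}. of_nat (card {k. k < n \<and> c k = x}) * F x)"
    by (intro sum.cong refl) simp
  finally show ?thesis using assms by (simp add: colour_classes_def add.assoc)
qed

lemma colour_classes_sum:
  assumes "colour_classes n c p q r t"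
  shows "p + q + r + t = n"
  using sum_colours[OF assms, of "\<lambda>_. 1 :: nat"] by simp

lemma c3_weight_trace_square:
  assumes "colour_classes n c p q r t"
  shows "(\<Sum>k<n. \<Sum>l<n. c3_weight (c k) (c l) * c3_weight (c l) (c k)) = 2 * of_nat (p * q + q * r + r * p)"
  unfolding sum_colours[OF assms, where F = "\<lambda>y. c3_weight x y * c3_weight y x" for x]
  \<comment> \<open>This \<open>F\<close> is the inner sum as the first unfolding leaves it, a
    function of the colour \<open>x\<close> alone.\<close>
  unfolding sum_colours[OF assms, where F = "\<lambda>x. of_nat p * (c3_weight x 0 * c3_weight 0 x) +
     of_nat q * (c3_weight x 1 * c3_weight 1 x) + of_nat r * (c3_weight x 2 * c3_weight 2 x) +
     of_nat t * (c3_weight x 3 * c3_weight 3 x)"]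
  by (simp add: c3_weight_def algebra_simps)

lemma c3_weight_cubic:
  assumes c: "colour_classes n c p q r t" and xy: "x \<le> 3" "y \<le> 3"
  shows "(\<Sum>k<n. \<Sum>l<n. c3_weight x (c k) * c3_weight (c k) (c l) * c3_weight (c l) y)
     = of_nat (p * q + q * r + r * p) * c3_weight x y"
proof -
  have X: "x = 0 \<or> x = 1 \<or> x = 2 \<or> x = 3" "y = 0 \<or> y = 1 \<or> y = 2 \<or> y = 3" using xy by auto
  show ?thesis
    unfolding sum_colours[OF c, where F = "\<lambda>z. c3_weight x w * c3_weight w z * c3_weight z y" for w]
    unfolding sum_colours[OF c, where F = "\<lambda>w. of_nat p * (c3_weight x w * c3_weight w 0 * c3_weight 0 y) +
       of_nat q * (c3_weight x w * c3_weight w 1 * c3_weight 1 y) +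
       of_nat r * (c3_weight x w * c3_weight w 2 * c3_weight 2 y) +
       of_nat t * (c3_weight x w * c3_weight w 3 * c3_weight 3 y)"]
    using X by (elim disjE) (simp_all add: c3_weight_def algebra_simps)
qed

section \<open>Mixed graphs through their Hermitian adjacency matrices\<close>

lemma herm_adj_carrier [simp]: "herm_adj D \<in> carrier_mat (nverts D) (nverts D)"
  by (simp add: herm_adj_def)

lemma herm_adj_index:
  "u < nverts D \<Longrightarrow> v < nverts D \<Longrightarrow> herm_adj D $$ (u, v) =
    (if {u, v} \<in> uedges D then 1 else if (u, v) \<in> arcs D then \<i> else if (v, u) \<in> arcs D then - \<i> else 0)"
  by (simp add: herm_adj_def)

lemma herm_adj_entries:
  "u < nverts D \<Longrightarrow> v < nverts D \<Longrightarrow> herm_adj D $$ (u, v) \<in> {0, 1, \<i>, - \<i>}"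
  by (simp add: herm_adj_index)

lemma
  assumes D: "is_mixed_graph D"
  shows herm_adj_hermitian:
      "u < nverts D \<Longrightarrow> v < nverts D \<Longrightarrow> herm_adj D $$ (v, u) = cnj (herm_adj D $$ (u, v))"
    and herm_adj_diag: "u < nverts D \<Longrightarrow> herm_adj D $$ (u, u) = 0"
    and uedges_iff_herm_adj:
      "u < nverts D \<Longrightarrow> v < nverts D \<Longrightarrow> {u, v} \<in> uedges D \<longleftrightarrow> herm_adj D $$ (u, v) = 1"
    and arcs_iff_herm_adj:
      "u < nverts D \<Longrightarrow> v < nverts D \<Longrightarrow> (u, v) \<in> arcs D \<longleftrightarrow> herm_adj D $$ (u, v) = \<i>"
proof -
  have no_loop: "{u, u} \<notin> uedges D" "(u, u) \<notin> arcs D" for u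
    using D by (auto simp: is_mixed_graph_def)
  have excl: "(v, u) \<notin> arcs D" "{u, v} \<notin> uedges D" "{v, u} \<notin> uedges D" if "(u, v) \<in> arcs D" for u v
    using D that by (auto simp: is_mixed_graph_def insert_commute)
  show "u < nverts D \<Longrightarrow> v < nverts D \<Longrightarrow> herm_adj D $$ (v, u) = cnj (herm_adj D $$ (u, v))"
    using excl(1,2)[of u v] excl(1,2)[of v u] insert_commute[of u v "{}"] by (auto simp: herm_adj_index)
  show "u < nverts D \<Longrightarrow> herm_adj D $$ (u, u) = 0"
    using no_loop[of u] by (simp add: herm_adj_index)
  show "u < nverts D \<Longrightarrow> v < nverts D \<Longrightarrow> {u, v} \<in> uedges D \<longleftrightarrow> herm_adj D $$ (u, v) = 1"
    by (auto simp: herm_adj_index complex_eq_iff)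
  show "u < nverts D \<Longrightarrow> v < nverts D \<Longrightarrow> (u, v) \<in> arcs D \<longleftrightarrow> herm_adj D $$ (u, v) = \<i>"
    using excl(1,2)[of u v] by (auto simp: herm_adj_index complex_eq_iff)
qed

lemma isomorphic_iff_herm_adj:
  assumes D: "is_mixed_graph D" and D': "is_mixed_graph D'"
  shows "isomorphic D D' \<longleftrightarrow> (\<exists>f. bij_betw f (verts D) (verts D') \<and>
    (\<forall>u\<in>verts D. \<forall>v\<in>verts D. herm_adj D $$ (u, v) = herm_adj D' $$ (f u, f v)))"
  unfolding isomorphic_def
proof (intro ex_cong1 conj_cong refl)
  fix f assume f: "bij_betw f (verts D) (verts D')"
  have fv: "f v < nverts D'" if "v < nverts D" for v
    using f that by (auto dest: bij_betwE)
  note e = uedges_iff_herm_adj[OF D] arcs_iff_herm_adj[OF D]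
    uedges_iff_herm_adj[OF D' fv fv] arcs_iff_herm_adj[OF D' fv fv]
  show "(\<forall>u\<in>verts D. \<forall>v\<in>verts D. ({u, v} \<in> uedges D \<longleftrightarrow> {f u, f v} \<in> uedges D') \<and>
      ((u, v) \<in> arcs D \<longleftrightarrow> (f u, f v) \<in> arcs D')) \<longleftrightarrow>
    (\<forall>u\<in>verts D. \<forall>v\<in>verts D. herm_adj D $$ (u, v) = herm_adj D' $$ (f u, f v))"
    (is "?L \<longleftrightarrow> ?R")
  proof
    assume ?L
    then show ?R by (simp add: herm_adj_index fv)
  next
    assume ?R
    then show ?L by (simp add: e)
  qed
qed

text \<open>Reads a suitable Hermitian array back as a mixed graph. It provides the witness
  \<open>D''\<close> in \<open>DHS_C3_vec\<close>.\<close>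

definition weighted_graph :: "nat \<Rightarrow> (nat \<Rightarrow> nat \<Rightarrow> complex) \<Rightarrow> mixed_graph" where
  "weighted_graph n h = \<lparr>nverts = n, uedges = {{u, v} |u v. u < n \<and> v < n \<and> h u v = 1},
     arcs = {(u, v). u < n \<and> v < n \<and> h u v = \<i>}\<rparr>"

lemma
  assumes herm: "\<And>u v. u < n \<Longrightarrow> v < n \<Longrightarrow> h v u = cnj (h u v)"
    and entries: "\<And>u v. u < n \<Longrightarrow> v < n \<Longrightarrow> h u v \<in> {0, 1, \<i>, - \<i>}"
    and diag: "\<And>u. u < n \<Longrightarrow> h u u = 0"
  shows is_mixed_graph_weighted_graph: "is_mixed_graph (weighted_graph n h)"
    and herm_adj_weighted_graph: "u < n \<Longrightarrow> v < n \<Longrightarrow> herm_adj (weighted_graph n h) $$ (u, v) = h u v"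
proof -
  have ue: "{u, v} \<in> uedges (weighted_graph n h) \<longleftrightarrow> h u v = 1" if "u < n" "v < n" for u v
    using that herm[of u v] by (auto simp: weighted_graph_def doubleton_eq_iff)
  have neq: "h u v \<noteq> 0 \<Longrightarrow> u < n \<Longrightarrow> v < n \<Longrightarrow> u \<noteq> v" for u v using diag by auto
  show "is_mixed_graph (weighted_graph n h)"
    unfolding is_mixed_graph_def
  proof (intro conjI)
    show "uedges (weighted_graph n h) \<subseteq> {{u, v} |u v. u \<in> verts (weighted_graph n h) \<and> v \<in> verts (weighted_graph n h) \<and> u \<noteq> v}"
    proof
      fix e assume "e \<in> uedges (weighted_graph n h)"
      then obtain u v where "e = {u, v}" "u < n" "v < n" "h u v = 1" by (auto simp: weighted_graph_def)
      moreover from this have "u \<noteq> v" using neq by simp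
      ultimately show "e \<in> {{u, v} |u v. u \<in> verts (weighted_graph n h) \<and> v \<in> verts (weighted_graph n h) \<and> u \<noteq> v}"
        by (auto simp: weighted_graph_def)
    qed
    show "arcs (weighted_graph n h) \<subseteq> {(u, v). u \<in> verts (weighted_graph n h) \<and> v \<in> verts (weighted_graph n h) \<and> u \<noteq> v}"
    proof clarify
      fix u v assume "(u, v) \<in> arcs (weighted_graph n h)"
      then have "u < n" "v < n" "h u v = \<i>" by (auto simp: weighted_graph_def)
      then show "u \<in> verts (weighted_graph n h) \<and> v \<in> verts (weighted_graph n h) \<and> u \<noteq> v"
        using neq[of u v] by (auto simp: weighted_graph_def)
    qed
    show "\<forall>(u, v)\<in>arcs (weighted_graph n h). (v, u) \<notin> arcs (weighted_graph n h) \<and> {u, v} \<notin> uedges (weighted_graph n h)"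
    proof clarify
      fix u v assume "(u, v) \<in> arcs (weighted_graph n h)"
      then have "u < n" "v < n" "h u v = \<i>" by (auto simp: weighted_graph_def)
      then show "(v, u) \<notin> arcs (weighted_graph n h) \<and> {u, v} \<notin> uedges (weighted_graph n h)"
        using herm[of u v] ue[of u v] by (auto simp: weighted_graph_def complex_eq_iff)
    qed
  qed
  show "herm_adj (weighted_graph n h) $$ (u, v) = h u v" if "u < n" "v < n"
  proof -
    have "nverts (weighted_graph n h) = n" "(u, v) \<in> arcs (weighted_graph n h) \<longleftrightarrow> h u v = \<i>"
      "(v, u) \<in> arcs (weighted_graph n h) \<longleftrightarrow> h v u = \<i>"
      using that by (auto simp: weighted_graph_def)
    then show ?thesis using that ue[of u v] herm[of u v] entries[of u v]
      by (auto simp: herm_adj_index)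
  qed
qed

lemma nverts_weighted_graph [simp]: "nverts (weighted_graph n h) = n"
  by (simp add: weighted_graph_def)

lemma
  assumes D: "is_mixed_graph D"
  shows is_mixed_graph_reversal: "is_mixed_graph (reversal D)"
    and herm_adj_reversal: "u < nverts D \<Longrightarrow> v < nverts D \<Longrightarrow>
      herm_adj (reversal D) $$ (u, v) = cnj (herm_adj D $$ (u, v))"
proof -
  show "is_mixed_graph (reversal D)"
    using D by (auto simp: is_mixed_graph_def reversal_def insert_commute)
  have "(u, v) \<notin> arcs D \<or> (v, u) \<notin> arcs D"
    using D by (auto simp: is_mixed_graph_def)
  then show "u < nverts D \<Longrightarrow> v < nverts D \<Longrightarrow> herm_adj (reversal D) $$ (u, v) = cnj (herm_adj D $$ (u, v))"
    by (auto simp: herm_adj_def reversal_def)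
qed

lemma nverts_reversal [simp]: "nverts (reversal D) = nverts D"
  by (simp add: reversal_def)

lemma unit_mult_cnj: "(x :: complex) \<in> {1, -1, \<i>, - \<i>} \<Longrightarrow> x * cnj x = 1"
  by auto

text \<open>The inverse of a diagonal matrix of units is its conjugate, so \<open>T\<close> is
  determined by \<open>S\<close> and the similarity can be read entry by entry.\<close>

lemma four_way_switching_iff:
  "four_way_switching D D' \<longleftrightarrow> is_mixed_graph D' \<and> nverts D' = nverts D \<and>
     (\<exists>d. (\<forall>v<nverts D. d v \<in> {1, -1, \<i>, - \<i>}) \<and>
       (\<forall>u<nverts D. \<forall>v<nverts D. herm_adj D' $$ (u, v) = cnj (d u) * herm_adj D $$ (u, v) * d v))"
  (is "_ \<longleftrightarrow> _ \<and> _ \<and> ?R")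
proof -
  define n where "n = nverts D"
  have H: "herm_adj D \<in> carrier_mat n n" by (simp add: n_def)
  have mult_diag: "(T * A * S) $$ (u, v) = T $$ (u, u) * A $$ (u, v) * S $$ (v, v)"
    if "T \<in> carrier_mat n n" "A \<in> carrier_mat n n" "S \<in> carrier_mat n n" "u < n" "v < n"
      and dT: "\<And>k. k < n \<Longrightarrow> k \<noteq> u \<Longrightarrow> T $$ (u, k) = 0" and dS: "\<And>k. k < n \<Longrightarrow> k \<noteq> v \<Longrightarrow> S $$ (k, v) = 0"
    for T A S :: "complex mat" and u v
  proof -
    have "(T * A * S) $$ (u, v) = (\<Sum>k<n. (T * A) $$ (u, k) * S $$ (k, v))"
      by (rule index_mult_mat_sum) (use that in auto)
    also have "\<dots> = (\<Sum>k<n. if k = v then (T * A) $$ (u, v) * S $$ (v, v) else 0)"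
      by (intro sum.cong refl) (simp add: dS)
    also have "\<dots> = (T * A) $$ (u, v) * S $$ (v, v)" using that(5) by simp
    also have "(T * A) $$ (u, v) = (\<Sum>k<n. T $$ (u, k) * A $$ (k, v))"
      by (rule index_mult_mat_sum) (use that in auto)
    also have "\<dots> = (\<Sum>k<n. if k = u then T $$ (u, u) * A $$ (u, v) else 0)"
      by (intro sum.cong refl) (simp add: dT)
    also have "\<dots> = T $$ (u, u) * A $$ (u, v)" using that(4) by simp
    finally show ?thesis .
  qed
  have "(\<exists>S\<in>switching_matrices n. \<exists>T. similar_mat_wit (herm_adj D') (herm_adj D) T S) \<longleftrightarrow> ?R"
    if n': "nverts D' = n"
  proof
    assume "\<exists>S\<in>switching_matrices n. \<exists>T. similar_mat_wit (herm_adj D') (herm_adj D) T S"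
    then obtain S T where S: "S \<in> switching_matrices n" and w: "similar_mat_wit (herm_adj D') (herm_adj D) T S"
      by blast
    have Sn: "S \<in> carrier_mat n n" and Sd: "diagonal_mat S" and Su: "\<And>v. v < n \<Longrightarrow> S $$ (v, v) \<in> {1, -1, \<i>, - \<i>}"
      using S by (auto simp: switching_matrices_def)
    have "herm_adj D' \<in> carrier_mat n n" using n' herm_adj_carrier[of D'] by simp
    note wD = similar_mat_witD2[OF this w]
    have S0: "S $$ (u, v) = 0" if "u < n" "v < n" "u \<noteq> v" for u v
      using Sd Sn that by (auto simp: diagonal_mat_def)
    have T: "T $$ (u, v) = (if u = v then cnj (S $$ (v, v)) else 0)" if uv: "u < n" "v < n" for u v
    proof -
      have "(T * S) $$ (u, v) = (\<Sum>k<n. T $$ (u, k) * S $$ (k, v))"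
        by (rule index_mult_mat_sum) (use wD uv in auto)
      also have "\<dots> = (\<Sum>k<n. if k = v then T $$ (u, v) * S $$ (v, v) else 0)"
        by (intro sum.cong refl) (simp add: S0 uv)
      also have "\<dots> = T $$ (u, v) * S $$ (v, v)" using uv by simp
      finally have "T $$ (u, v) * S $$ (v, v) = (if u = v then 1 else 0)" using wD(1) uv by simp
      then have "T $$ (u, v) * (S $$ (v, v) * cnj (S $$ (v, v))) = (if u = v then cnj (S $$ (v, v)) else 0)"
        by (simp add: mult.assoc[symmetric])
      then show ?thesis using unit_mult_cnj[OF Su[OF uv(2)]] by simp
    qed
    have "herm_adj D' $$ (u, v) = cnj (S $$ (u, u)) * herm_adj D $$ (u, v) * S $$ (v, v)" if "u < n" "v < n" for u v
      unfolding wD(3) using mult_diag[of T "herm_adj D" S u v] wD H Sn T S0 that by simp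
    then show ?R using Su unfolding n_def[symmetric] by (intro exI[of _ "\<lambda>v. S $$ (v, v)"]) simp
  next
    assume ?R
    then obtain d where d: "\<And>v. v < n \<Longrightarrow> d v \<in> {1, -1, \<i>, - \<i>}"
      and eq: "\<And>u v. u < n \<Longrightarrow> v < n \<Longrightarrow> herm_adj D' $$ (u, v) = cnj (d u) * herm_adj D $$ (u, v) * d v"
      unfolding n_def[symmetric] by blast
    define S where "S = mat n n (\<lambda>(u, v). if u = v then d v else 0)"
    define T where "T = mat n n (\<lambda>(u, v). if u = v then cnj (d v) else 0)"
    have Sn: "S \<in> carrier_mat n n" and Tn: "T \<in> carrier_mat n n" by (simp_all add: S_def T_def)
    have D'n: "herm_adj D' \<in> carrier_mat n n" using n' herm_adj_carrier[of D'] by simp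
    have S: "S \<in> switching_matrices n"
      using d by (auto simp: switching_matrices_def S_def diagonal_mat_def)
    have "similar_mat_wit (herm_adj D') (herm_adj D) T S"
    proof (rule similar_mat_witI[of _ _ n])
      have "(T * S) $$ (u, v) = (1\<^sub>m n) $$ (u, v)" "(S * T) $$ (u, v) = (1\<^sub>m n) $$ (u, v)" if "u < n" "v < n" for u v
      proof -
        \<comment> \<open>The identity matrix in the middle brings the two products into the shape
          of \<open>mult_diag\<close>.\<close>
        have "(T * S) $$ (u, v) = (T * 1\<^sub>m n * S) $$ (u, v)" "(S * T) $$ (u, v) = (S * 1\<^sub>m n * T) $$ (u, v)"
          using Sn Tn by simp_all
        then show "(T * S) $$ (u, v) = (1\<^sub>m n) $$ (u, v)" "(S * T) $$ (u, v) = (1\<^sub>m n) $$ (u, v)"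
          using mult_diag[of T "1\<^sub>m n" S u v] mult_diag[of S "1\<^sub>m n" T u v] Sn Tn that unit_mult_cnj[OF d[OF that(1)]]
          by (auto simp: S_def T_def mult.commute)
      qed
      then show "T * S = 1\<^sub>m n" "S * T = 1\<^sub>m n"
        using Sn Tn by (auto intro!: eq_matI simp del: index_mult_mat(1))
      show "herm_adj D' = T * herm_adj D * S"
      proof (rule eq_matI)
        fix u v assume "u < dim_row (T * herm_adj D * S)" "v < dim_col (T * herm_adj D * S)"
        then have uv: "u < n" "v < n" using Sn Tn by auto
        then show "herm_adj D' $$ (u, v) = (T * herm_adj D * S) $$ (u, v)"
          using mult_diag[of T "herm_adj D" S u v] Sn Tn H eq[OF uv] by (simp add: S_def T_def)
      qed (use D'n Sn Tn in auto)
    qed (use D'n Sn Tn H in auto)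
    then show "\<exists>S\<in>switching_matrices n. \<exists>T. similar_mat_wit (herm_adj D') (herm_adj D) T S" using S by blast
  qed
  then show ?thesis unfolding four_way_switching_def n_def by auto
qed

section \<open>The spectrum of the cyclic tripartite graph\<close>

definition c3_colour :: "nat \<Rightarrow> nat \<Rightarrow> nat \<Rightarrow> nat" where
  "c3_colour a b k = (if k < a then 0 else if k < a + b then 1 else 2)"

lemma nverts_C3_vec [simp]: "nverts (C3_vec a b c) = a + b + c"
  by (simp add: C3_vec_def Let_def)

lemma herm_adj_C3_vec:
  "u < a + b + c \<Longrightarrow> v < a + b + c \<Longrightarrow>
    herm_adj (C3_vec a b c) $$ (u, v) = c3_weight (c3_colour a b u) (c3_colour a b v)"
  by (auto simp: herm_adj_def C3_vec_def Let_def c3_weight_def c3_colour_def)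

lemma colour_classes_C3_vec: "colour_classes (a + b + c) (c3_colour a b) a b c 0"
proof -
  have "{k. k < a + b + c \<and> c3_colour a b k = 0} = {..<a}"
    "{k. k < a + b + c \<and> c3_colour a b k = 1} = {a..<a + b}"
    "{k. k < a + b + c \<and> c3_colour a b k = 2} = {a + b..<a + b + c}"
    "{k. k < a + b + c \<and> c3_colour a b k = 3} = {}"
    by (auto simp: c3_colour_def)
  then show ?thesis by (simp add: colour_classes_def c3_colour_def)
qed

lemma herm_spectrum_C3_vec:
  assumes s: "s = a * b + b * c + c * a" "s > 0"
  shows "herm_spectrum (C3_vec a b c) =
    {#of_real (sqrt s), - of_real (sqrt s)#} + replicate_mset (a + b + c - 2) 0"
  unfolding herm_spectrum_def
proof (rule proots_char_poly_rank_two)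
  define n where "n = a + b + c"
  define A where "A = herm_adj (C3_vec a b c)"
  let ?c = "c3_colour a b"
  have cc: "colour_classes n ?c a b c 0" unfolding n_def by (rule colour_classes_C3_vec)
  have A: "A \<in> carrier_mat n n" unfolding A_def n_def using herm_adj_carrier[of "C3_vec a b c"] by simp
  have ent: "A $$ (u, v) = c3_weight (?c u) (?c v)" if "u < n" "v < n" for u v
    using that unfolding A_def n_def by (rule herm_adj_C3_vec)
  have r2: "(complex_of_real (sqrt s))\<^sup>2 = of_nat s" by (simp flip: of_real_power)
  show "herm_adj (C3_vec a b c) \<in> carrier_mat (a + b + c) (a + b + c)"
    using herm_adj_carrier[of "C3_vec a b c"] by simp
  show "complex_of_real (sqrt s) \<noteq> 0" using s(2) by simp
  show "herm_adj (C3_vec a b c) ^\<^sub>m 3 = (complex_of_real (sqrt s))\<^sup>2 \<cdot>\<^sub>m herm_adj (C3_vec a b c)"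
    unfolding r2 A_def[symmetric]
  proof (rule eq_matI)
    fix i j assume "i < dim_row (of_nat s \<cdot>\<^sub>m A)" "j < dim_col (of_nat s \<cdot>\<^sub>m A)"
    then have ij: "i < n" "j < n" using A by auto
    have "(A ^\<^sub>m 3) $$ (i, j) = (\<Sum>k<n. \<Sum>l<n. A $$ (i, k) * A $$ (k, l) * A $$ (l, j))"
      by (rule index_cube_mat[OF A ij])
    also have "\<dots> = (\<Sum>k<n. \<Sum>l<n. c3_weight (?c i) (?c k) * c3_weight (?c k) (?c l) * c3_weight (?c l) (?c j))"
      by (intro sum.cong refl) (simp add: ent ij)
    also have "\<dots> = of_nat s * A $$ (i, j)"
      unfolding ent[OF ij] s by (rule c3_weight_cubic[OF cc]) (auto simp: c3_colour_def)
    finally show "(A ^\<^sub>m 3) $$ (i, j) = (of_nat s \<cdot>\<^sub>m A) $$ (i, j)" using A ij by simp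
  qed (use A in auto)
  show "mat_trace (herm_adj (C3_vec a b c)) = 0"
    using A ent unfolding A_def[symmetric] mat_trace_def by (auto simp: c3_weight_def intro!: sum.neutral)
  have "A ^\<^sub>m 2 = A * A" using A by (simp add: numeral_2_eq_2)
  then have "mat_trace (A ^\<^sub>m 2) = (\<Sum>k<n. \<Sum>l<n. c3_weight (?c k) (?c l) * c3_weight (?c l) (?c k))"
    unfolding mat_trace_mult[OF A A] by (simp add: mat_trace_mult[OF A A] ent)
  also have "\<dots> = 2 * of_nat s" unfolding s by (rule c3_weight_trace_square[OF cc])
  finally show "mat_trace (herm_adj (C3_vec a b c) ^\<^sub>m 2) = 2 * (complex_of_real (sqrt s))\<^sup>2"
    unfolding r2 A_def .
qed

section \<open>Cyclic tripartite mixed graphs\<close>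

lemma ex_colour_preserving_bij:
  assumes fin: "finite A" "finite B"
    and card: "\<And>x. card {k \<in> A. c k = x} = card {k \<in> B. c' k = x}"
  obtains f where "bij_betw f A B" "\<And>k. k \<in> A \<Longrightarrow> c' (f k) = c k"
proof -
  have "\<exists>g. bij_betw g {k \<in> A. c k = x} {k \<in> B. c' k = x}" for x
    using fin card by (intro finite_same_card_bij) auto
  then obtain g where g: "\<And>x. bij_betw (g x) {k \<in> A. c k = x} {k \<in> B. c' k = x}" by metis
  define f where "f k = g (c k) k" for k
  have fB: "f k \<in> B \<and> c' (f k) = c k" if "k \<in> A" for k
    using bij_betwE[OF g[of "c k"]] that by (auto simp: f_def)
  have "inj_on f A"
  proof (rule inj_onI)
    fix k l assume kl: "k \<in> A" "l \<in> A" "f k = f l"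
    then have "c k = c l" using fB by metis
    moreover from this have "g (c k) k = g (c k) l" using kl(3) by (simp add: f_def)
    ultimately show "k = l"
      using bij_betw_imp_inj_on[OF g[of "c k"]] kl by (auto dest: inj_onD)
  qed
  moreover have "f ` A = B"
  proof
    show "f ` A \<subseteq> B" using fB by auto
    show "B \<subseteq> f ` A"
    proof
      fix y assume "y \<in> B"
      then have "y \<in> g (c' y) ` {k \<in> A. c k = c' y}"
        using bij_betw_imp_surj_on[OF g[of "c' y"]] by auto
      then obtain k where "k \<in> A" "c k = c' y" "y = g (c' y) k" by auto
      then show "y \<in> f ` A" by (intro image_eqI[of _ _ k]) (simp_all add: f_def)
    qed
  qed
  ultimately have "bij_betw f A B" by (simp add: bij_betw_def)
  then show ?thesis using fB that by blast
qed

lemma colour_classes_bij: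
  assumes c: "colour_classes n c p q r t" and c': "colour_classes n c' p q r t"
  obtains f where "bij_betw f {..<n} {..<n}" "\<And>k. k < n \<Longrightarrow> c' (f k) = c k"
proof -
  have "card {k \<in> {..<n}. c k = x} = card {k \<in> {..<n}. c' k = x}" for x
  proof (cases "x \<le> 3")
    case True
    then have "x = 0 \<or> x = 1 \<or> x = 2 \<or> x = 3" by auto
    then show ?thesis using c c' by (elim disjE) (simp_all add: colour_classes_def)
  next
    case False
    then have "{k \<in> {..<n}. c k = x} = {}" "{k \<in> {..<n}. c' k = x} = {}"
      using c c' by (auto simp: colour_classes_def)
    then show ?thesis by (simp only:)
  qed
  from ex_colour_preserving_bij[OF _ _ this] that show ?thesis by auto
qed

lemma colour_classes_rotate:
  assumes "colour_classes n c p q r t"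
  obtains c' where "colour_classes n c' r p q t"
    "\<And>k l. k < n \<Longrightarrow> l < n \<Longrightarrow> c3_weight (c k) (c l) = c3_weight (c' k) (c' l)"
proof
  let ?c' = "\<lambda>k. if c k = 3 then 3 else if c k = 2 then 0 else Suc (c k)"
  have le: "c k \<le> 3" if "k < n" for k using assms that by (simp add: colour_classes_def)
  have "{k. k < n \<and> ?c' k = 0} = {k. k < n \<and> c k = 2}" "{k. k < n \<and> ?c' k = 1} = {k. k < n \<and> c k = 0}"
    "{k. k < n \<and> ?c' k = 2} = {k. k < n \<and> c k = 1}" "{k. k < n \<and> ?c' k = 3} = {k. k < n \<and> c k = 3}"
    by auto
  then show "colour_classes n ?c' r p q t"
    using assms unfolding colour_classes_def by auto
  show "c3_weight (c k) (c l) = c3_weight (?c' k) (?c' l)" if "k < n" "l < n" for k l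
  proof -
    have "c k = 0 \<or> c k = 1 \<or> c k = 2 \<or> c k = 3" "c l = 0 \<or> c l = 1 \<or> c l = 2 \<or> c l = 3"
      using le that by force+
    then show ?thesis by (elim disjE) (simp_all add: c3_weight_def)
  qed
qed

lemma colour_classes_swap:
  assumes "colour_classes n c p q r t"
  obtains c' where "colour_classes n c' q p r t"
    "\<And>k l. k < n \<Longrightarrow> l < n \<Longrightarrow> c3_weight (c k) (c l) = cnj (c3_weight (c' k) (c' l))"
proof
  let ?c' = "\<lambda>k. if c k = 0 then 1 else if c k = 1 then 0 else c k"
  have le: "c k \<le> 3" if "k < n" for k using assms that by (simp add: colour_classes_def)
  have "{k. k < n \<and> ?c' k = 0} = {k. k < n \<and> c k = 1}" "{k. k < n \<and> ?c' k = 1} = {k. k < n \<and> c k = 0}"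
    "{k. k < n \<and> ?c' k = 2} = {k. k < n \<and> c k = 2}" "{k. k < n \<and> ?c' k = 3} = {k. k < n \<and> c k = 3}"
    by auto
  then show "colour_classes n ?c' q p r t"
    using assms unfolding colour_classes_def by auto
  show "c3_weight (c k) (c l) = cnj (c3_weight (?c' k) (?c' l))" if "k < n" "l < n" for k l
  proof -
    have "c k = 0 \<or> c k = 1 \<or> c k = 2 \<or> c k = 3" "c l = 0 \<or> c l = 1 \<or> c l = 2 \<or> c l = 3"
      using le that by force+
    then show ?thesis by (elim disjE) (simp_all add: c3_weight_def)
  qed
qed

text \<open>Rotations of the part numbers keep the weights and one transposition conjugates them;
  together they reach all six orders.\<close>

lemma colour_classes_reorder:
  assumes c: "colour_classes n c p q r t"
    and perm: "(p, q, r) \<in> {(x, y, z), (y, z, x), (z, x, y), (y, x, z), (x, z, y), (z, y, x)}"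
  obtains c' where "colour_classes n c' x y z t"
    "(\<forall>k<n. \<forall>l<n. c3_weight (c k) (c l) = c3_weight (c' k) (c' l)) \<or>
     (\<forall>k<n. \<forall>l<n. c3_weight (c k) (c l) = cnj (c3_weight (c' k) (c' l)))"
proof -
  obtain c1 where c1: "colour_classes n c1 r p q t"
    "\<And>k l. k < n \<Longrightarrow> l < n \<Longrightarrow> c3_weight (c k) (c l) = c3_weight (c1 k) (c1 l)"
    using colour_classes_rotate[OF c] by blast
  obtain c2 where c2: "colour_classes n c2 q r p t"
    "\<And>k l. k < n \<Longrightarrow> l < n \<Longrightarrow> c3_weight (c1 k) (c1 l) = c3_weight (c2 k) (c2 l)"
    using colour_classes_rotate[OF c1(1)] by blast
  obtain d where d: "colour_classes n d q p r t"
    "\<And>k l. k < n \<Longrightarrow> l < n \<Longrightarrow> c3_weight (c k) (c l) = cnj (c3_weight (d k) (d l))"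
    using colour_classes_swap[OF c] by blast
  obtain d1 where d1: "colour_classes n d1 p r q t"
    "\<And>k l. k < n \<Longrightarrow> l < n \<Longrightarrow> c3_weight (c1 k) (c1 l) = cnj (c3_weight (d1 k) (d1 l))"
    using colour_classes_swap[OF c1(1)] by blast
  obtain d2 where d2: "colour_classes n d2 r q p t"
    "\<And>k l. k < n \<Longrightarrow> l < n \<Longrightarrow> c3_weight (c2 k) (c2 l) = cnj (c3_weight (d2 k) (d2 l))"
    using colour_classes_swap[OF c2(1)] by blast
  consider "(p, q, r) = (x, y, z)" | "(p, q, r) = (y, z, x)" | "(p, q, r) = (z, x, y)"
    | "(p, q, r) = (y, x, z)" | "(p, q, r) = (x, z, y)" | "(p, q, r) = (z, y, x)" using perm by auto
  then show ?thesis
  proof cases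
    case 1 then show ?thesis using that[of c] c by simp
  next
    case 2 then show ?thesis using that[of c1] c1 by simp
  next
    case 3 then show ?thesis using that[of c2] c1 c2 by simp
  next
    case 4 then show ?thesis using that[of d] d by simp
  next
    case 5 then show ?thesis using that[of d1] c1 d1 by simp
  next
    case 6 then show ?thesis using that[of d2] c1 c2 d2 by simp
  qed
qed

section \<open>Part sizes with prescribed sums\<close>

lemma tripartite_sizes:
  fixes n a p q r t :: nat
  assumes an: "a < n" "a > 0" "a\<^sup>2 < 2 * n"
    and no: "\<not> (\<exists>p::nat. prime p \<and> [p = 1] (mod 6) \<and> p dvd a)"
    and sum: "p + q + r + t = (n - a) + n + (n + a)"
    and e2: "p * q + q * r + r * p = (n - a) * n + n * (n + a) + (n + a) * (n - a)"
  shows "t = 0 \<and> (p, q, r) \<in> {(n - a, n, n + a), (n, n + a, n - a), (n + a, n - a, n),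
     (n, n - a, n + a), (n - a, n + a, n), (n + a, n, n - a)}"
proof -
  define N A P Q R T where "N = int n" and "A = int a" and "P = int p" and "Q = int q" and "R = int r" and "T = int t"
  have na: "int (n - a) = N - A" using an by (simp add: N_def A_def of_nat_diff)
  have sum': "P + Q + R + T = 3 * N"
    using arg_cong[OF sum, of int] by (simp add: na N_def[symmetric] A_def[symmetric] P_def Q_def R_def T_def)
  have "int (p * q + q * r + r * p) = (N - A) * N + N * (N + A) + (N + A) * (N - A)"
    unfolding e2 by (simp add: na N_def[symmetric] A_def[symmetric])
  then have e2': "P * Q + Q * R + R * P = 3 * N\<^sup>2 - A\<^sup>2"
    by (simp add: P_def Q_def R_def power2_eq_square algebra_simps)
  have A2: "A\<^sup>2 < 2 * N" using an(3) unfolding A_def N_def by (metis of_nat_less_iff of_nat_mult of_nat_numeral of_nat_power)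
  have "T = 0"
  proof (rule ccontr)
    assume "T \<noteq> 0"
    then have T1: "T \<ge> 1" by (simp add: T_def)
    \<comment> \<open>For a fixed sum the products are largest at equal sizes, so t >= 1 gives at
      most (3n - 1)^2 / 3 = 3n^2 - 2n + 1/3. The prescribed value 3n^2 - a^2 is at least 3n^2 - 2n +
      1.\<close>
    have "0 \<le> (P - Q)\<^sup>2 + (Q - R)\<^sup>2 + (R - P)\<^sup>2" by simp
    then have "3 * (P * Q + Q * R + R * P) \<le> (P + Q + R)\<^sup>2"
      by (simp add: power2_eq_square algebra_simps)
    moreover have "(P + Q + R)\<^sup>2 \<le> (3 * N - 1)\<^sup>2"
      by (rule power_mono) (use sum' T1 in \<open>auto simp: P_def Q_def R_def\<close>)
    moreover have "(3 * N - 1)\<^sup>2 = 9 * N\<^sup>2 - 6 * N + 1" by (simp add: power2_eq_square algebra_simps)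
    ultimately have "3 * (3 * N\<^sup>2 - A\<^sup>2) \<le> 9 * N\<^sup>2 - 6 * N + 1" unfolding e2' by (metis order_trans)
    moreover have "A\<^sup>2 + 1 \<le> 2 * N" using A2 by simp
    ultimately show False by simp
  qed
  define x y where "x = P - N" and "y = Q - N"
  have R: "R = N - x - y" using sum' \<open>T = 0\<close> by (simp add: x_def y_def)
  have P: "P = N + x" and Q: "Q = N + y" by (simp_all add: x_def y_def)
  have xy: "x\<^sup>2 + x * y + y\<^sup>2 = A\<^sup>2"
    using e2' unfolding P Q R by (simp add: power2_eq_square algebra_simps)
  then have "x = 0 \<or> y = 0 \<or> x + y = 0"
    unfolding A_def by (rule trivial_eisenstein_square[OF no an(2)])
  then have "(x, y) \<in> {(- A, 0), (0, A), (A, - A), (0, - A), (- A, A), (A, 0)}"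
  proof (elim disjE)
    assume "x = 0"
    then show ?thesis using xy by (auto simp: power2_eq_iff)
  next
    assume "y = 0"
    then show ?thesis using xy by (auto simp: power2_eq_iff)
  next
    assume "x + y = 0"
    then have "y = - x" by simp
    then have "x\<^sup>2 = A\<^sup>2" using xy by (simp add: power2_eq_square)
    then show ?thesis using \<open>y = - x\<close> by (auto simp: power2_eq_iff)
  qed
  then have PQR: "(P, Q, R) \<in> {(N - A, N, N + A), (N, N + A, N - A), (N + A, N - A, N),
     (N, N - A, N + A), (N - A, N + A, N), (N + A, N, N - A)}"
    unfolding insert_iff prod.inject empty_iff by (elim disjE conjE) (simp_all add: P Q R)
  have cast: "m = n - a \<longleftrightarrow> int m = N - A" "m = n \<longleftrightarrow> int m = N" "m = n + a \<longleftrightarrow> int m = N + A" for m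
    using an(1) by (auto simp: N_def A_def of_nat_diff)
  have "(p, q, r) \<in> {(n - a, n, n + a), (n, n + a, n - a), (n + a, n - a, n),
     (n, n - a, n + a), (n - a, n + a, n), (n + a, n, n - a)}"
    using PQR unfolding P_def Q_def R_def insert_iff prod.inject empty_iff cast .
  then show ?thesis using \<open>T = 0\<close> by (simp add: T_def)
qed

lemma herm_spectrum_nverts: "size (herm_spectrum D) = nverts D"
  unfolding herm_spectrum_def size_proots_complex using degree_monic_char_poly[OF herm_adj_carrier] by blast

text \<open>Switching preserves the products \<open>h k l * h l k\<close>, so the trace of the
  square can be computed from the colours alone.\<close>

lemma c3_weight_mult_unit:
  assumes "x \<in> {1, -1, \<i>, - \<i>}" "y \<in> {1, -1, \<i>, - \<i>}"
  shows "(cnj x * w * y) * (cnj y * w' * x) = w * w'"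
proof -
  have "(cnj x * w * y) * (cnj y * w' * x) = (x * cnj x) * (y * cnj y) * (w * w')"
    by (simp only: mult_ac)
  then show ?thesis unfolding unit_mult_cnj[OF assms(1)] unit_mult_cnj[OF assms(2)] by simp
qed

section \<open>Cospectral mates and the DHS property\<close>

lemma cospectral_C3_vec_structure:
  assumes D': "is_mixed_graph D'" and cosp: "H_cospectral D' (C3_vec a b e)"
    and s: "a * b + b * e + e * a > 0"
  obtains c d p q r t where "nverts D' = a + b + e"
    "colour_classes (a + b + e) c p q r t"
    "\<And>k. k < a + b + e \<Longrightarrow> d k \<in> {1, -1, \<i>, - \<i>}"
    "\<And>k l. k < a + b + e \<Longrightarrow> l < a + b + e \<Longrightarrow>
        herm_adj D' $$ (k, l) = cnj (d k) * c3_weight (c k) (c l) * d l"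
    "p * q + q * r + r * p = a * b + b * e + e * a"
proof -
  define N where "N = a + b + e"
  define S where "S = a * b + b * e + e * a"
  define \<rho> where "\<rho> = complex_of_real (sqrt S)"
  have S0: "S > 0" using s unfolding S_def .
  have \<rho>: "\<rho> \<in> \<real>" "\<rho> \<noteq> 0" "\<rho>\<^sup>2 = of_nat S" using S0 by (simp_all add: \<rho>_def flip: of_real_power)
  have n': "nverts D' = N"
    using cosp herm_spectrum_nverts[of D'] herm_spectrum_nverts[of "C3_vec a b e"] by (simp add: H_cospectral_def N_def)
  have roots: "proots (char_poly (herm_adj D')) = {#\<rho>, - \<rho>#} + replicate_mset (N - 2) 0"
    using cosp herm_spectrum_C3_vec[OF S_def] s
    unfolding H_cospectral_def herm_spectrum_def[of D'] \<rho>_def N_def S_def by simp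
  let ?h = "\<lambda>u v. herm_adj D' $$ (u, v)"
  have H: "herm_adj D' \<in> carrier_mat N N" using herm_adj_carrier[of D'] n' by simp
  have herm: "?h l k = cnj (?h k l)" and entries: "?h k l \<in> {0, 1, \<i>, - \<i>}" and diag: "?h k k = 0"
    if "k < N" "l < N" for k l
    by (rule herm_adj_hermitian[OF D'] herm_adj_entries herm_adj_diag[OF D']; use that n' in simp)+
  interpret rank_two_weights N ?h
  proof
    fix i j k l assume lt: "i < N" "j < N" "k < N" "l < N" and ij: "?h i j \<noteq> 0"
    have one: "?h i j * ?h j i = 1" using entries[OF lt(1,2)] herm[OF lt(1,2)] ij by auto
    show "?h k l = ?h k j * ?h j i * ?h i l + ?h k i * ?h i j * ?h j l"
      by (rule hermitian_two_eigenvalues_minor[OF H _ \<rho>(1,2) roots lt diag[OF lt(1,1)] diag[OF lt(2,2)] one];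
          rule herm; assumption)
  qed (rule herm entries diag; assumption)+
  have tr: "(\<Sum>k<N. \<Sum>l<N. ?h k l * ?h l k) = 2 * of_nat S"
  proof -
    have "herm_adj D' ^\<^sub>m 2 = herm_adj D' * herm_adj D'" using H by (simp add: numeral_2_eq_2)
    then show ?thesis using mat_trace_square_two_eigenvalues[OF H roots] \<rho>(3) mat_trace_mult[OF H H] by simp
  qed
  \<comment> \<open>The classification starts from an edge; one exists because the trace of the
    square is positive.\<close>
  have "\<exists>i<N. \<exists>j<N. ?h i j \<noteq> 0"
  proof (rule ccontr)
    assume "\<not> ?thesis"
    then have "(\<Sum>k<N. \<Sum>l<N. ?h k l * ?h l k) = 0" by (intro sum.neutral ballI) auto
    then show False using tr S0 by simp
  qed
  then obtain i j where "i < N" "j < N" "?h i j \<noteq> 0" by blast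
  then obtain c d where c: "\<And>k. k < N \<Longrightarrow> c k \<le> 3" and d: "\<And>k. k < N \<Longrightarrow> d k \<in> {1, -1, \<i>, - \<i>}"
    and h: "\<And>k l. k < N \<Longrightarrow> l < N \<Longrightarrow> ?h k l = cnj (d k) * c3_weight (c k) (c l) * d l"
    using weights_classification by blast
  define p q r t where "p = card {k. k < N \<and> c k = 0}" and "q = card {k. k < N \<and> c k = 1}"
    and "r = card {k. k < N \<and> c k = 2}" and "t = card {k. k < N \<and> c k = 3}"
  have cc: "colour_classes N c p q r t"
    using c by (simp add: colour_classes_def p_def q_def r_def t_def)
  have "(\<Sum>k<N. \<Sum>l<N. ?h k l * ?h l k) = (\<Sum>k<N. \<Sum>l<N. c3_weight (c k) (c l) * c3_weight (c l) (c k))"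
    by (intro sum.cong refl) (simp only: h lessThan_iff c3_weight_mult_unit[OF d d])
  then have "2 * of_nat (p * q + q * r + r * p) = (2 * of_nat S :: complex)"
    using tr c3_weight_trace_square[OF cc] by (simp only:)
  then have "p * q + q * r + r * p = S" by (simp only: mult_cancel_left of_nat_eq_iff) simp
  then show ?thesis using that[of c p q r t d] n' cc d h unfolding N_def S_def by blast
qed

text \<open>The arithmetic is isolated in the assumption \<open>sizes\<close>. What remains is to
  carry \<open>D'\<close> to the vertices of the tripartite graph along a bijection that matches the
  parts.\<close>

lemma DHS_C3_vec:
  assumes s: "a * b + b * e + e * a > 0"
    and sizes: "\<And>p q r t. p + q + r + t = a + b + e \<Longrightarrow> p * q + q * r + r * p = a * b + b * e + e * a \<Longrightarrow>
      t = 0 \<and> (p, q, r) \<in> {(a, b, e), (b, e, a), (e, a, b), (b, a, e), (a, e, b), (e, b, a)}"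
  shows "DHS (C3_vec a b e)"
  unfolding DHS_def
proof (intro allI impI, elim conjE)
  fix D' assume D': "is_mixed_graph D'" and cosp: "H_cospectral D' (C3_vec a b e)"
  define N where "N = a + b + e"
  define D where "D = C3_vec a b e"
  let ?h = "\<lambda>u v. herm_adj D' $$ (u, v)"
  obtain c d p q r t where n': "nverts D' = N" and c: "colour_classes N c p q r t"
    and d: "\<And>k. k < N \<Longrightarrow> d k \<in> {1, -1, \<i>, - \<i>}"
    and h: "\<And>k l. k < N \<Longrightarrow> l < N \<Longrightarrow> ?h k l = cnj (d k) * c3_weight (c k) (c l) * d l"
    and e2: "p * q + q * r + r * p = a * b + b * e + e * a"
    using cospectral_C3_vec_structure[OF D' cosp s] unfolding N_def by metis
  have t: "t = 0" and perm: "(p, q, r) \<in> {(a, b, e), (b, e, a), (e, a, b), (b, a, e), (a, e, b), (e, b, a)}"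
    using sizes[OF _ e2, of t] colour_classes_sum[OF c] unfolding N_def by auto
  obtain c' where c': "colour_classes N c' a b e 0"
    and w: "(\<forall>k<N. \<forall>l<N. c3_weight (c k) (c l) = c3_weight (c' k) (c' l)) \<or>
     (\<forall>k<N. \<forall>l<N. c3_weight (c k) (c l) = cnj (c3_weight (c' k) (c' l)))"
    using colour_classes_reorder[OF c perm] unfolding t by blast
  obtain f where f: "bij_betw f {..<N} {..<N}" "\<And>k. k < N \<Longrightarrow> c3_colour a b (f k) = c' k"
    using colour_classes_bij[OF c' colour_classes_C3_vec[of a b e, folded N_def]] by blast
  define g where "g = inv_into {..<N} f"
  have g: "g k < N" "f (g k) = k" if "k < N" for k
    using f(1) that by (auto simp: g_def bij_betw_def inv_into_into f_inv_into_f)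
      (metis imageI inv_into_into lessThan_iff)
  have gf: "g (f k) = k" if "k < N" for k
    using f(1) that by (simp add: g_def bij_betw_def)
  have fN: "f k < N" if "k < N" for k using f(1) that by (auto dest: bij_betwE)
  have hD: "herm_adj D $$ (u, v) = c3_weight (c' (g u)) (c' (g v))" if "u < N" "v < N" for u v
    using herm_adj_C3_vec[of u a b e v] that f(2)[of "g u"] f(2)[of "g v"] g unfolding D_def N_def by simp
  have nD: "nverts D = N" by (simp add: D_def N_def)
  have herm: "?h l k = cnj (?h k l)" and entries: "?h k l \<in> {0, 1, \<i>, - \<i>}" and diag: "?h k k = 0"
    if "k < N" "l < N" for k l
    by (rule herm_adj_hermitian[OF D'] herm_adj_entries herm_adj_diag[OF D']; use that n' in simp)+
  have hg: "?h (g v) (g u) = cnj (?h (g u) (g v))" "?h (g u) (g v) \<in> {0, 1, \<i>, - \<i>}" "?h (g u) (g u) = 0"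
    if "u < N" "v < N" for u v
    by (rule herm entries diag; use g that in simp)+
  from w show "\<exists>D''. four_way_switching (C3_vec a b e) D'' \<and> (isomorphic D' D'' \<or> isomorphic D' (reversal D''))"
  proof
    assume w: "\<forall>k<N. \<forall>l<N. c3_weight (c k) (c l) = c3_weight (c' k) (c' l)"
    \<comment> \<open>\<open>D'\<close> relabelled along \<open>f\<close>: the parts now sit on the
      intervals of \<open>C3_vec\<close>, so that the same vertex labels can be compared under
      switching.\<close>
    define D'' where "D'' = weighted_graph N (\<lambda>u v. ?h (g u) (g v))"
    have D'': "is_mixed_graph D''" unfolding D''_def
      by (rule is_mixed_graph_weighted_graph; rule hg; assumption)
    have h'': "herm_adj D'' $$ (u, v) = ?h (g u) (g v)" if "u < N" "v < N" for u v
      unfolding D''_def by (rule herm_adj_weighted_graph) (rule that | (rule hg; assumption))+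
    have n'': "nverts D'' = N" by (simp add: D''_def)
    have "four_way_switching D D''"
      unfolding four_way_switching_iff nD
      by (intro conjI exI[of _ "\<lambda>u. d (g u)"]) (use D'' n'' d g w h hD h'' in auto)
    moreover have "isomorphic D' D''"
      unfolding isomorphic_iff_herm_adj[OF D' D''] n' n''
      by (intro exI[of _ f]) (use f(1) h'' gf fN in auto)
    ultimately show ?thesis unfolding D_def by blast
  next
    assume w: "\<forall>k<N. \<forall>l<N. c3_weight (c k) (c l) = cnj (c3_weight (c' k) (c' l))"
    \<comment> \<open>The arguments are exchanged, which conjugates the matrix: it is the reversal
      of the relabelled \<open>D'\<close> that is a switching, and its unit factors are the
      conjugates of \<open>d\<close>.\<close>
    define D'' where "D'' = weighted_graph N (\<lambda>u v. ?h (g v) (g u))"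
    have D'': "is_mixed_graph D''" unfolding D''_def
      by (rule is_mixed_graph_weighted_graph; rule hg; assumption)
    have h'': "herm_adj D'' $$ (u, v) = ?h (g v) (g u)" if "u < N" "v < N" for u v
      unfolding D''_def by (rule herm_adj_weighted_graph) (rule that | (rule hg; assumption))+
    have n'': "nverts D'' = N" by (simp add: D''_def)
    have dc: "cnj (d (g v)) \<in> {1, -1, \<i>, - \<i>}" if "v < N" for v
      using d[OF g(1)[OF that]] by auto
    have sw: "herm_adj D'' $$ (u, v) = d (g u) * herm_adj D $$ (u, v) * cnj (d (g v))" if uv: "u < N" "v < N" for u v
      using h''[OF uv] herm[of "g u" "g v"] h[of "g u" "g v"] w hD[OF uv] g uv by simp
    have "four_way_switching D D''"
      unfolding four_way_switching_iff nD
      by (intro conjI exI[of _ "\<lambda>u. cnj (d (g u))"]) (use D'' n'' dc sw in simp_all)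
    moreover have "isomorphic D' (reversal D'')"
      unfolding isomorphic_iff_herm_adj[OF D' is_mixed_graph_reversal[OF D'']] n' n'' nverts_reversal
    proof (intro exI[of _ f] conjI ballI f(1))
      fix u v assume "u \<in> {..<N}" "v \<in> {..<N}"
      then have uv: "u < N" "v < N" by auto
      have "herm_adj (reversal D'') $$ (f u, f v) = cnj (?h v u)"
        using herm_adj_reversal[OF D'', of "f u" "f v"] h'' gf fN n'' uv by simp
      then show "?h u v = herm_adj (reversal D'') $$ (f u, f v)" using herm[OF uv(2,1)] by simp
    qed
    ultimately show ?thesis unfolding D_def by blast
  qed
qed

section \<open>Part sizes as invariants of switching\<close>

lemma c3_weight_eq_0_iff: "x \<le> 2 \<Longrightarrow> y \<le> 2 \<Longrightarrow> c3_weight x y = 0 \<longleftrightarrow> x = y"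
proof -
  assume "x \<le> 2" "y \<le> 2"
  then have "x = 0 \<or> x = 1 \<or> x = 2" "y = 0 \<or> y = 1 \<or> y = 2" by auto
  then show ?thesis by (elim disjE) (simp_all add: c3_weight_def)
qed

text \<open>The zeros in the row of a vertex are exactly its own part, itself included.\<close>

lemma card_nonadjacent_C3_vec:
  assumes u: "u < a + b + e"
  shows "card {v. v < a + b + e \<and> herm_adj (C3_vec a b e) $$ (u, v) = 0} =
    (if u < a then a else if u < a + b then b else e)"
proof -
  have "{v. v < a + b + e \<and> herm_adj (C3_vec a b e) $$ (u, v) = 0} =
    {v. v < a + b + e \<and> c3_colour a b u = c3_colour a b v}"
  proof -
    have "c3_colour a b v \<le> 2" for v by (simp add: c3_colour_def)
    then show ?thesis using u by (auto simp: herm_adj_C3_vec c3_weight_eq_0_iff)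
  qed
  also have "\<dots> = (if u < a then {..<a} else if u < a + b then {a..<a + b} else {a + b..<a + b + e})"
  proof -
    have "0 = c3_colour a b v \<longleftrightarrow> v < a" "1 = c3_colour a b v \<longleftrightarrow> a \<le> v \<and> v < a + b"
      "2 = c3_colour a b v \<longleftrightarrow> a + b \<le> v" for v
      by (auto simp: c3_colour_def)
    moreover have "c3_colour a b u = (if u < a then 0 else if u < a + b then 1 else 2)"
      by (simp add: c3_colour_def)
    ultimately show ?thesis by auto
  qed
  finally show ?thesis by simp
qed

text \<open>Switching and reversal keep the zero pattern and an isomorphism carries it over, so the
  number of zeros in a row, which is a part size, is preserved. Zero is removed because an empty
  part has no row.\<close>

lemma switching_isomorphic_C3_vec_sizes:
  assumes sw: "four_way_switching (C3_vec a b e) D''"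
    and iso: "isomorphic (C3_vec p q r) D'' \<or> isomorphic (C3_vec p q r) (reversal D'')"
  shows "{p, q, r} - {0} \<subseteq> {a, b, e}"
proof
  fix x assume x: "x \<in> {p, q, r} - {0}"
  define N where "N = a + b + e"
  have D'': "is_mixed_graph D''" and n'': "nverts D'' = N"
    using sw by (simp_all add: four_way_switching_iff N_def)
  obtain d where d: "\<forall>v<N. d v \<in> {1, -1, \<i>, - \<i>}"
    and sw': "\<forall>u<N. \<forall>v<N. herm_adj D'' $$ (u, v) = cnj (d u) * herm_adj (C3_vec a b e) $$ (u, v) * d v"
    using sw unfolding four_way_switching_iff nverts_C3_vec N_def by blast
  have zero: "herm_adj D'' $$ (u, v) = 0 \<longleftrightarrow> herm_adj (C3_vec a b e) $$ (u, v) = 0" if "u < N" "v < N" for u v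
  proof -
    have "d u \<noteq> 0" "d v \<noteq> 0" using d that by force+
    then show ?thesis using sw' that by simp
  qed
  obtain f where f: "bij_betw f {..<p + q + r} {..<N}"
    and hf: "\<forall>u<p + q + r. \<forall>v<p + q + r. herm_adj (C3_vec p q r) $$ (u, v) = 0 \<longleftrightarrow> herm_adj D'' $$ (f u, f v) = 0"
  proof -
    have *: "herm_adj (reversal D'') $$ (u, v) = 0 \<longleftrightarrow> herm_adj D'' $$ (u, v) = 0" if "u < N" "v < N" for u v
      using herm_adj_reversal[OF D''] that n'' by simp
    from iso show ?thesis
    proof
      assume "isomorphic (C3_vec p q r) D''"
      then show ?thesis
        unfolding isomorphic_iff_herm_adj[OF is_mixed_graph_C3_vec D''] n'' nverts_C3_vec
        using that by auto
    next
      assume "isomorphic (C3_vec p q r) (reversal D'')"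
      then obtain f where f: "bij_betw f {..<p + q + r} {..<N}"
        "\<forall>u\<in>{..<p + q + r}. \<forall>v\<in>{..<p + q + r}. herm_adj (C3_vec p q r) $$ (u, v) = herm_adj (reversal D'') $$ (f u, f v)"
        unfolding isomorphic_iff_herm_adj[OF is_mixed_graph_C3_vec is_mixed_graph_reversal[OF D'']] n'' nverts_C3_vec nverts_reversal
        by blast
      have "f u < N" if "u < p + q + r" for u using f(1) that by (auto dest: bij_betwE)
      then show ?thesis using that[OF f(1)] f(2) * by auto
    qed
  qed
  have fN: "f u < N" if "u < p + q + r" for u using f that by (auto dest: bij_betwE)
  obtain u where u: "u < p + q + r" "x = (if u < p then p else if u < p + q then q else r)"
  proof -
    consider "x = p" "p > 0" | "x = q" "q > 0" | "x = r" "r > 0" using x by auto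
    then show ?thesis
    proof cases
      case 1 then show ?thesis using that[of 0] by simp
    next
      case 2 then show ?thesis using that[of p] by simp
    next
      case 3 then show ?thesis using that[of "p + q"] by simp
    qed
  qed
  have "x = card {v. v < p + q + r \<and> herm_adj (C3_vec p q r) $$ (u, v) = 0}"
    using card_nonadjacent_C3_vec[OF u(1)] u(2) by simp
  also have "\<dots> = card (f ` {v. v < p + q + r \<and> herm_adj (C3_vec p q r) $$ (u, v) = 0})"
    using f by (intro card_image[symmetric] inj_on_subset[OF bij_betw_imp_inj_on[OF f]]) auto
  also have "f ` {v. v < p + q + r \<and> herm_adj (C3_vec p q r) $$ (u, v) = 0} =
      {v. v < N \<and> herm_adj (C3_vec a b e) $$ (f u, v) = 0}"
  proof (intro equalityI subsetI)
    fix y assume "y \<in> f ` {v. v < p + q + r \<and> herm_adj (C3_vec p q r) $$ (u, v) = 0}"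
    then show "y \<in> {v. v < N \<and> herm_adj (C3_vec a b e) $$ (f u, v) = 0}"
      using hf zero fN u(1) by auto
  next
    fix y assume y: "y \<in> {v. v < N \<and> herm_adj (C3_vec a b e) $$ (f u, v) = 0}"
    then obtain v where "v < p + q + r" "y = f v" using bij_betw_imp_surj_on[OF f] by (metis (mono_tags) imageE lessThan_iff mem_Collect_eq)
    then show "y \<in> f ` {v. v < p + q + r \<and> herm_adj (C3_vec p q r) $$ (u, v) = 0}"
      using y hf zero fN u(1) by auto
  qed
  also have "card {v. v < N \<and> herm_adj (C3_vec a b e) $$ (f u, v) = 0} \<in> {a, b, e}"
    using card_nonadjacent_C3_vec[of "f u" a b e] fN[OF u(1)] by (simp add: N_def)
  finally show "x \<in> {a, b, e}" .
qed

text \<open>The cospectral mate has part sizes n + x, n + y, n - x - y for a nontrivial solution (x,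
  y); the pairwise products sum to 3n^2 - a^2 on both sides.\<close>

lemma not_DHS_C3_vec:
  fixes a n :: nat
  assumes an: "a < n" "a > 0" "a\<^sup>2 < 2 * n"
    and p: "prime p" "[p = 1] (mod 6)" "p dvd a"
  shows "\<not> DHS (C3_vec (n - a) n (n + a))"
proof
  assume dhs: "DHS (C3_vec (n - a) n (n + a))"
  define N A where "N = int n" and "A = int a"
  obtain x y :: int where xy: "x\<^sup>2 + x * y + y\<^sup>2 = A\<^sup>2" and nz: "x \<noteq> 0" "y \<noteq> 0" "x + y \<noteq> 0"
    using nontrivial_eisenstein_square[OF p an(2)] unfolding A_def by metis
  define z where "z = - x - y"
  \<comment> \<open>Completing the square in x^2 + xy + y^2 = a^2 yields this hypothesis for each of
    the three deviations from n, and the conclusion makes all three sizes positive.\<close>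
  have bound: "\<bar>w\<bar> < N" if w: "3 * w\<^sup>2 \<le> 4 * A\<^sup>2" for w
  proof (rule ccontr)
    assume "\<not> \<bar>w\<bar> < N"
    then have "N\<^sup>2 \<le> w\<^sup>2" by (metis N_def abs_of_nat abs_le_square_iff linorder_not_less)
    moreover have "A\<^sup>2 < 2 * N" using an(3) unfolding A_def N_def by (metis of_nat_less_iff of_nat_mult of_nat_numeral of_nat_power)
    \<comment> \<open>This leaves only n <= 2, but n exceeds a, and a is at least the prime p, which
      is neither 1 nor 2.\<close>
    ultimately have "3 * N\<^sup>2 < 8 * N" using w by linarith
    then have "N * (3 * N) < N * 8" by (simp add: power2_eq_square algebra_simps)
    then have "N < 3" using an(1) by (simp add: N_def mult_less_cancel_left)
    moreover have "a \<ge> 3"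
    proof -
      have "p \<noteq> 1" "p \<noteq> 2" using p(1,2) by (auto simp: cong_def)
      then have "p \<ge> 3" using prime_ge_2_nat[OF p(1)] by linarith
      then show ?thesis using dvd_imp_le[OF p(3) an(2)] by linarith
    qed
    ultimately show False using an(1) by (simp add: N_def)
  qed
  have "\<bar>x\<bar> < N"
  proof (rule bound)
    have "4 * A\<^sup>2 = 3 * x\<^sup>2 + (x + 2 * y)\<^sup>2" unfolding xy[symmetric] by (simp add: power2_eq_square algebra_simps)
    then show "3 * x\<^sup>2 \<le> 4 * A\<^sup>2" by simp
  qed
  moreover have "\<bar>y\<bar> < N"
  proof (rule bound)
    have "4 * A\<^sup>2 = 3 * y\<^sup>2 + (y + 2 * x)\<^sup>2" unfolding xy[symmetric] by (simp add: power2_eq_square algebra_simps)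
    then show "3 * y\<^sup>2 \<le> 4 * A\<^sup>2" by simp
  qed
  moreover have "\<bar>z\<bar> < N"
  proof (rule bound)
    have "4 * A\<^sup>2 = 3 * z\<^sup>2 + (x - y)\<^sup>2" unfolding xy[symmetric] z_def by (simp add: power2_eq_square algebra_simps)
    then show "3 * z\<^sup>2 \<le> 4 * A\<^sup>2" by simp
  qed
  moreover define P Q R where "P = nat (N + x)" and "Q = nat (N + y)" and "R = nat (N + z)"
  ultimately have PQR: "int P = N + x" "int Q = N + y" "int R = N + z" "P > 0" "Q > 0" "R > 0" by auto
  have na: "int (n - a) = N - A" using an by (simp add: N_def A_def of_nat_diff)
  have "int (P + Q + R) = int (n - a + n + (n + a))"
    by (simp add: PQR na N_def[symmetric] A_def[symmetric] z_def)
  then have sum: "P + Q + R = n - a + n + (n + a)" by (simp only: of_nat_eq_iff)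
  have "int (P * Q + Q * R + R * P) = 3 * N\<^sup>2 - A\<^sup>2"
    unfolding xy[symmetric] by (simp add: PQR z_def power2_eq_square algebra_simps)
  also have "\<dots> = int ((n - a) * n + n * (n + a) + (n + a) * (n - a))"
    by (simp only: of_nat_add of_nat_mult na N_def[symmetric] A_def[symmetric])
      (simp add: power2_eq_square algebra_simps)
  finally have e2: "P * Q + Q * R + R * P = (n - a) * n + n * (n + a) + (n + a) * (n - a)"
    by (simp only: of_nat_eq_iff)
  have pos: "P * Q + Q * R + R * P > 0" using PQR by simp
  have "H_cospectral (C3_vec P Q R) (C3_vec (n - a) n (n + a))"
    unfolding H_cospectral_def
    using herm_spectrum_C3_vec[OF refl pos] herm_spectrum_C3_vec[OF e2 pos] sum by simp
  then obtain D'' where "four_way_switching (C3_vec (n - a) n (n + a)) D''"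
    "isomorphic (C3_vec P Q R) D'' \<or> isomorphic (C3_vec P Q R) (reversal D'')"
    using dhs is_mixed_graph_C3_vec unfolding DHS_def by blast
  from switching_isomorphic_C3_vec_sizes[OF this]
  have "P \<in> {n - a, n, n + a}" "Q \<in> {n - a, n, n + a}" using PQR by auto
  then have "int P \<in> {N - A, N, N + A}" "int Q \<in> {N - A, N, N + A}"
    using na by (auto simp: N_def A_def)
  \<comment> \<open>Since x + y is nonzero the two signs agree, and x = y turns the norm into 3a^2
    instead of a^2.\<close>
  then have "x = A \<or> x = - A" "y = A \<or> y = - A" using nz PQR by auto
  then have "x = y" using nz by auto
  then have "3 * x\<^sup>2 = A\<^sup>2" "x\<^sup>2 = A\<^sup>2" using xy \<open>x = A \<or> x = - A\<close> by (auto simp: power2_eq_square)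
  then show False using nz by simp
qed

theorem corollary5p13:
  fixes a n :: nat
  assumes "n > a" and "a > 0" and "a\<^sup>2 < 2 * n"
  shows "DHS (C3_vec (n - a) n (n + a)) \<longleftrightarrow> \<not> (\<exists>p::nat. prime p \<and> [p = 1] (mod 6) \<and> p dvd a)"
proof
  assume "DHS (C3_vec (n - a) n (n + a))"
  then show "\<not> (\<exists>p::nat. prime p \<and> [p = 1] (mod 6) \<and> p dvd a)"
    using not_DHS_C3_vec[OF assms] by blast
next
  assume no: "\<not> (\<exists>p::nat. prime p \<and> [p = 1] (mod 6) \<and> p dvd a)"
  show "DHS (C3_vec (n - a) n (n + a))"
  proof (rule DHS_C3_vec)
    show "0 < (n - a) * n + n * (n + a) + (n + a) * (n - a)" using assms by simp
  qed (rule tripartite_sizes[OF assms no])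
qed

end
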